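(* Let $f:[0,2\pi]\to\mathbb R$ be Borel measurable and let $\mu$ be a positive, finite Borel measure on $[0,2\pi]$. Then for every $\varepsilon>0$ there exists a continuous function $g:[0,2\pi]\to\mathbb R$ with uniformly convergent Fourier series such that $\mu(\{x\in[0,2\pi]: f(x)\neq g(x)\})<\varepsilon$.
   Context: The Fourier series of a continuous $g:[0,2\pi]\to\mathbb R$ is the usual trigonometric series $\sum_{k\in\mathbb Z}\hat g(k)e^{ikx}$ with $\hat g(k)=\frac1{2\pi}\int_0^{2\pi}g(t)e^{-ikt}\,dt$ (integration with respect to Lebesgue measure). It is uniformly convergent if the symmetric partial sums $\sum_{|k|\le N}\hat g(k)e^{ikx}$ converge uniformly on $[0,2\pi]$ as $N\to\infty$.
   Formalization: The formal theorem adds the hypothesis f(0)=f(2π) or μ({0})=0 or μ({2π})=0, since uniform convergence forces g(0)=g(2π); without it the claim fails, e.g. for μ=δ_0+δ_{2π}, f the indicator of {2π}, ε=1/2. *)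

theory Defs
  imports "HOL-Analysis.Analysis"
begin

definition fourier_coeff :: "(real \<Rightarrow> real) \<Rightarrow> int \<Rightarrow> complex" where
  "fourier_coeff g k =
     1 / (2 * of_real pi) *
       (LINT t:{0..2*pi}|lborel. of_real (g t) * exp (- (\<i> * of_int k * of_real t)))"

definition fourier_partial_sum :: "(real \<Rightarrow> real) \<Rightarrow> nat \<Rightarrow> real \<Rightarrow> complex" where
  "fourier_partial_sum g N x =
     (\<Sum>k\<in>{- int N..int N}. fourier_coeff g k * exp (\<i> * of_int k * of_real x))"

text \<open>
  The limit is not required to be \<open>g\<close>. For \<open>g\<close> continuous on \<open>[0, 2\<pi>]\<close> it necessarily is, because
  a uniform limit has the same Fourier coefficients; since the partial sums are \<open>2\<pi>\<close>-periodic,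
  this forces \<open>g 0 = g (2\<pi>)\<close>.
\<close>
definition uniformly_convergent_fourier :: "(real \<Rightarrow> real) \<Rightarrow> bool" where
  "uniformly_convergent_fourier g \<longleftrightarrow>
     uniformly_convergent_on {0..2*pi} (fourier_partial_sum g)"

end

theory Submission
  imports Defs
begin

text \<open>
  By Lusin's theorem on the circle and Tietze's extension theorem, \<open>f\<close> agrees with a continuous
  periodic function off a set of small measure (\<open>lusin\<close>), so \<open>f\<close> may be taken to be continuous and
  periodic. The assumption on the endpoints is what allows the passage from the interval to the
  circle.

  The rest follows Menshov's idea of pushing the pieces of a function to high frequencies. A
  continuous function \<open>f\<close> is close to a sum of pieces \<open>f (y q) * \<phi> (x - y q)\<close>, where the \<open>\<phi> (x - y q)\<close>
  form a fine partition of unity by hat functions. Each piece is multiplied by \<open>\<psi> (n q * x - s q)\<close>,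
  where \<open>\<psi>\<close> is a trigonometric polynomial of mean \<open>0\<close> that is almost \<open>1\<close> outside a small arc, and where
  the \<open>n q\<close> increase rapidly. The pieces then occupy disjoint ranges of frequencies, so that a
  partial sum cuts at most one of them, and a single piece is under control because its Fourier
  coefficients are absolutely summable with a bound that depends neither on the fineness of the
  partition nor on the accuracy (\<open>hat_fourier\<close>, \<open>lacunary_partial_sums\<close>). The sum of the products is far from \<open>f\<close>
  only where some active \<open>\<psi> (n q * x - s q)\<close> is away from \<open>1\<close>. For Lebesgue measure this set would be
  small for all phases \<open>s q\<close>; for an arbitrary finite measure, averaging over the phases yields some
  that make it small. Thus a continuous function bounded by \<open>B\<close> is approximated, off a set of
  measure \<open>\<epsilon>\<close> and to any accuracy, by a trigonometric polynomial with partial sums bounded by \<open>C * B\<close>,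
  where \<open>C\<close> depends only on the measure and on \<open>\<epsilon>\<close> (\<open>approximate_correction\<close>).

  Since \<open>C\<close> does not depend on the accuracy, the remaining error can be corrected again and again
  with summable bounds. The corrections add up to a function with uniformly convergent Fourier
  series that equals \<open>f\<close> off a small set (\<open>fourier_series_of_series\<close>, \<open>exact_correction\<close>).
\<close>

section \<open>Hat functions with small Fourier coefficients\<close>

text \<open>
  The square of the Dirichlet sum, normalised so that its translates by the \<open>P\<close>-th parts of
  the circle add up to \<open>1\<close>; this is the Fejer kernel of order \<open>P\<close> divided by \<open>P\<close>.
\<close>

definition fejer :: "nat \<Rightarrow> real \<Rightarrow> real" where
  "fejer P x = (cmod (\<Sum>k<P. cis (real k * x)))\<^sup>2 / (real P)\<^sup>2"

lemma fejer_nonneg: "0 \<le> fejer P x"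
  by (simp add: fejer_def)

lemma fejer_expand:
  "complex_of_real (fejer P x) =
     (\<Sum>k<P. \<Sum>l<P. cis (of_int (int k - int l) * x)) / (of_nat P)\<^sup>2"
proof -
  have "complex_of_real ((cmod (\<Sum>k<P. cis (real k * x)))\<^sup>2)
      = (\<Sum>k<P. cis (real k * x)) * cnj (\<Sum>k<P. cis (real k * x))"
    by (metis complex_norm_square of_real_power)
  also have "\<dots> = (\<Sum>k<P. \<Sum>l<P. cis (real k * x) * cis (- (real l * x)))"
    by (simp add: sum_product cis_cnj)
  also have "\<dots> = (\<Sum>k<P. \<Sum>l<P. cis (of_int (int k - int l) * x))"
    by (simp add: cis_mult algebra_simps)
  finally show ?thesis
    by (simp add: fejer_def)
qed

lemma sum_cis_roots:
  assumes "0 < P" "\<bar>d\<bar> < int P"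
  shows "(\<Sum>j<P. cis (of_int d * (x - 2 * pi * real j / real P)))
           = (if d = 0 then of_nat P else 0)"
proof (cases "d = 0")
  case False
  define z where "z = cis (- (2 * pi * of_int d / real P))"
  have "z \<noteq> 1"
  proof
    assume "z = 1"
    then have "sin (2 * pi * of_int d / real P / 2) = 0 "
      using dist_exp_i_1[of "- (2 * pi * of_int d / real P)"]
      by (simp add: z_def cis_conv_exp)
    then obtain i where "2 * pi * of_int d / real P / 2 = of_int i * pi"
      using sin_zero_iff_int2 by blast
    then have "real_of_int d = of_int (i * int P)"
      using assms(1) by (simp add: field_simps)
    then have "d = i * int P"
      by linarith
    moreover have "\<bar>i\<bar> \<ge> 1"
      using False \<open>d = i * int P\<close> by auto
    ultimately show False
      using assms(2) mult_right_mono[of 1 "\<bar>i\<bar>" "int P"] by (simp add: abs_mult)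
  qed
  moreover have "z ^ P = 1"
  proof -
    have "z ^ P = cis (2 * pi * of_int (- d))"
      unfolding z_def Complex.DeMoivre by (rule arg_cong[of _ _ cis]) (use assms(1) in simp)
    then show ?thesis
      using cis_multiple_2pi[of "of_int (-d)"] by simp
  qed
  ultimately have "(\<Sum>j<P. z ^ j) = 0"
    by (simp add: geometric_sum)
  moreover have "cis (of_int d * (x - 2 * pi * real j / real P)) = cis (of_int d * x) * z ^ j" for j
    unfolding z_def Complex.DeMoivre cis_mult by (rule arg_cong[of _ _ cis]) (simp add: field_simps)
  ultimately show ?thesis
    using False by (simp flip: sum_distrib_left)
qed simp

text \<open>
  Averaging over the \<open>P\<close>-th parts of the circle only keeps the frequencies divisible by \<open>P\<close>, and the
  kernel has no such frequency besides \<open>0\<close>.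
\<close>

lemma fejer_partition:
  assumes "0 < P"
  shows "(\<Sum>j<P. fejer P (x - 2 * pi * real j / real P)) = 1"
proof -
  have "complex_of_real (\<Sum>j<P. fejer P (x - 2 * pi * real j / real P))
      = (\<Sum>j<P. \<Sum>k<P. \<Sum>l<P. cis (of_int (int k - int l) * (x - 2 * pi * real j / real P)))
          / (of_nat P)\<^sup>2"
    by (simp only: of_real_sum fejer_expand sum_divide_distrib)
  also have "(\<Sum>j<P. \<Sum>k<P. \<Sum>l<P. cis (of_int (int k - int l) * (x - 2 * pi * real j / real P)))
      = (\<Sum>k<P. \<Sum>l<P. \<Sum>j<P. cis (of_int (int k - int l) * (x - 2 * pi * real j / real P)))"
    by (subst sum.swap, rule sum.cong[OF refl], rule sum.swap)
  also have "\<dots> = (\<Sum>k<P. \<Sum>l<P. if k = l then of_nat P else 0)"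
    by (intro sum.cong refl, subst sum_cis_roots) (use assms in auto)
  also have "\<dots> = (of_nat P)\<^sup>2"
    by (simp add: power2_eq_square)
  finally have "complex_of_real (\<Sum>j<P. fejer P (x - 2 * pi * real j / real P)) = of_real 1"
    using assms by simp
  then show ?thesis
    using of_real_eq_iff by blast
qed

lemma fejer_le:
  assumes "cis x \<noteq> 1"
  shows "fejer P x \<le> 4 / (real P * cmod (cis x - 1))\<^sup>2"
proof -
  have "(\<Sum>k<P. cis (real k * x)) = (cis x ^ P - 1) / (cis x - 1)"
    using geometric_sum[OF assms, of P] by (simp only: Complex.DeMoivre)
  then have "cmod (\<Sum>k<P. cis (real k * x)) = cmod (cis x ^ P - 1) / cmod (cis x - 1)"
    by (simp add: norm_divide)
  also have "\<dots> \<le> 2 / cmod (cis x - 1)"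
    using norm_triangle_ineq4[of "cis x ^ P" 1]
    by (intro divide_right_mono) (auto simp: norm_power)
  finally have "(cmod (\<Sum>k<P. cis (real k * x)))\<^sup>2 \<le> (2 / cmod (cis x - 1))\<^sup>2"
    by (intro power_mono) auto
  then show ?thesis
    using divide_right_mono[of _ _ "(real P)\<^sup>2"]
    by (fastforce simp: fejer_def power_mult_distrib power_divide ac_simps)
qed

text \<open>
  A discrete hat function of width comparable to \<open>1 / Q\<close>. The indicator of \<open>L\<close> consecutive points of
  the grid with \<open>P = L * Q\<close> points is convolved with its own reflection, and the result with the
  Fejer kernel of order \<open>P\<close>. Autocorrelation is what makes every Fourier coefficient nonnegative,
  and the kernel turns the grid function into a trigonometric polynomial. As \<open>L\<close> grows, the width
  stays the same and the tail disappears.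
\<close>

definition hat :: "nat \<Rightarrow> nat \<Rightarrow> real \<Rightarrow> real" where
  "hat Q L x = (\<Sum>a<L. \<Sum>b<L. fejer (L * Q) (x - 2 * pi * (real a - real b) / real (L * Q))) / real L"

lemma hat_nonneg: "0 \<le> hat Q L x"
  by (simp add: hat_def fejer_nonneg sum_nonneg)

lemma hat_partition:
  assumes "0 < Q" "0 < L"
  shows "(\<Sum>q<Q. hat Q L (x - 2 * pi * real q / real Q)) = 1"
proof -
  let ?P = "L * Q"
  let ?F = "\<lambda>b j. fejer ?P ((x + 2 * pi * real b / real ?P) - 2 * pi * real j / real ?P)"
  have eq: "fejer ?P (x - 2 * pi * real q / real Q - 2 * pi * (real a - real b) / real ?P) = ?F b (a + q * L)"
    for q a b
    by (rule arg_cong[of _ _ "fejer ?P"]) (use assms in \<open>simp add: field_simps\<close>)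
  have "(\<Sum>q<Q. hat Q L (x - 2 * pi * real q / real Q))
      = (\<Sum>q<Q. \<Sum>a<L. \<Sum>b<L. ?F b (a + q * L)) / real L"
    by (simp only: hat_def eq sum_divide_distrib)
  also have "(\<Sum>q<Q. \<Sum>a<L. \<Sum>b<L. ?F b (a + q * L)) = (\<Sum>q<Q. \<Sum>b<L. \<Sum>a<L. ?F b (a + q * L))"
    by (intro sum.cong refl sum.swap)
  also have "\<dots> = (\<Sum>b<L. \<Sum>q<Q. \<Sum>a<L. ?F b (a + q * L))"
    by (rule sum.swap)
  also have "\<dots> = (\<Sum>b<L. \<Sum>j<?P. ?F b j)"
  proof (rule sum.cong[OF refl])
    fix b
    have "(\<Sum>a<L. ?F b (a + q * L)) = sum (?F b) {q * L..<q * L + L}" for q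
      by (rule sum.reindex_bij_witness[of _ "\<lambda>j. j - q * L" "\<lambda>a. a + q * L"]) auto
    then show "(\<Sum>q<Q. \<Sum>a<L. ?F b (a + q * L)) = (\<Sum>j<?P. ?F b j)"
      by (simp only: sum.nat_group mult.commute[of Q L])
  qed
  also have "\<dots> = real L"
    by (subst fejer_partition) (use assms in auto)
  finally show ?thesis
    using assms by simp
qed

lemma norm_cis_diff: "cmod (cis (x - y) - 1) = cmod (cis x - cis y)"
proof -
  have "cis x - cis y = cis y * (cis (x - y) - 1)"
    by (simp add: algebra_simps cis_mult)
  then show ?thesis
    by (simp add: norm_mult)
qed

lemma norm_cis_minus_1_le: "cmod (cis x - 1) \<le> \<bar>x\<bar>"
  using dist_exp_i_1[of x] abs_sin_x_le_abs_x[of "x / 2"] by (simp add: cis_conv_exp)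

text \<open>
  The double sum has \<open>L\<^sup>2\<close> terms, each at most \<open>1 / L\<^sup>2\<close> by the quadratic decay of the Fejer kernel:
  the shifts move a point by at most \<open>2 * pi / Q\<close>, half of the assumed distance.
\<close>

lemma hat_tail:
  assumes Q: "0 < Q" and L: "0 < L" and far: "4 * pi / real Q \<le> cmod (cis x - 1)"
  shows "hat Q L x \<le> 1 / real L"
proof -
  let ?P = "L * Q"
  have "fejer ?P (x - 2 * pi * (real a - real b) / real ?P) \<le> 1 / (real L)\<^sup>2"
    if "a < L" "b < L" for a b
  proof -
    define y where "y = 2 * pi * (real a - real b) / real ?P"
    have "\<bar>y\<bar> = 2 * pi * \<bar>real a - real b\<bar> / real ?P"
      by (simp add: y_def abs_mult)
    also have "\<dots> \<le> 2 * pi * real L / real ?P"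
      using that by (intro divide_right_mono mult_left_mono) auto
    also have "\<dots> = 2 * pi / real Q"
      using L by simp
    finally have "cmod (cis y - 1) \<le> 2 * pi / real Q"
      using norm_cis_minus_1_le[of y] by linarith
    moreover have "cmod (cis x - 1) \<le> cmod (cis x - cis y) + cmod (cis y - 1)"
      using norm_triangle_ineq[of "cis x - cis y" "cis y - 1"] by simp
    ultimately have ge: "2 * pi / real Q \<le> cmod (cis (x - y) - 1)"
      using far unfolding norm_cis_diff by linarith
    have pos: "0 < 2 * pi / real Q"
      using Q by simp
    have "2 * real L \<le> real ?P * (2 * pi / real Q)"
      using Q pi_ge_two mult_left_mono[of 1 pi "real L"] by simp
    also have "\<dots> \<le> real ?P * cmod (cis (x - y) - 1)"
      using ge by (intro mult_left_mono) auto
    finally have le: "2 * real L \<le> real ?P * cmod (cis (x - y) - 1)" .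
    have "fejer ?P (x - y) \<le> 4 / (real ?P * cmod (cis (x - y) - 1))\<^sup>2"
      by (rule fejer_le) (use ge pos in auto)
    also have "\<dots> \<le> 4 / (2 * real L)\<^sup>2"
      using le L Q by (intro divide_left_mono power_mono mult_pos_pos zero_less_power) auto
    also have "\<dots> = 1 / (real L)\<^sup>2"
      by (simp add: power_mult_distrib)
    finally show ?thesis
      by (simp add: y_def)
  qed
  then have "(\<Sum>a<L. \<Sum>b<L. fejer ?P (x - 2 * pi * (real a - real b) / real ?P))
      \<le> (\<Sum>a<L. \<Sum>b<L. 1 / (real L)\<^sup>2)"
    by (intro sum_mono) auto
  also have "\<dots> = 1"
    using L by (simp add: power2_eq_square)
  finally show ?thesis
    unfolding hat_def using L by (intro divide_right_mono) auto
qed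

text \<open>
  Nonnegative coefficients add up to the value at \<open>0\<close>, which is at most \<open>1\<close>. Thus the absolute sum
  of the coefficients is bounded however narrow the hat is and however small its tail; all
  bounds on partial sums come from here.
\<close>

lemma hat_fourier:
  assumes "0 < Q" "0 < L"
  obtains \<rho> :: "int \<Rightarrow> real" where
    "\<And>k. 0 \<le> \<rho> k" "\<rho> 0 = 1 / real Q"
    "(\<Sum>k\<in>{- int (L * Q)..int (L * Q)}. \<rho> k) \<le> 1"
    "\<And>x. complex_of_real (hat Q L x)
       = (\<Sum>k\<in>{- int (L * Q)..int (L * Q)}. of_real (\<rho> k) * cis (of_int k * x))"
proof -
  define P where "P = L * Q"
  have P: "0 < P"
    using assms by (simp add: P_def)
  define r :: "int \<Rightarrow> real" where
    "r d = (cmod (\<Sum>a<L. cis (of_int d * (- 2 * pi * real a / real P))))\<^sup>2 / (real L * (real P)\<^sup>2)" for d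
  \<comment> \<open>Pairs of frequencies of the Dirichlet sum; \<open>\<rho> d\<close> collects those with difference \<open>d\<close>.\<close>
  define S where "S = {..<P} \<times> {..<P}"
  define \<rho> where "\<rho> d = real (card {p \<in> S. int (fst p) - int (snd p) = d}) * r d" for d
  have r_eq: "complex_of_real (r d) = (\<Sum>a<L. \<Sum>b<L. cis (of_int d * (- 2 * pi * (real a - real b) / real P)))
                 / (of_nat L * (of_nat P)\<^sup>2)" for d
  proof -
    have "complex_of_real ((cmod (\<Sum>a<L. cis (of_int d * (- 2 * pi * real a / real P))))\<^sup>2)
        = (\<Sum>a<L. cis (of_int d * (- 2 * pi * real a / real P)))
            * cnj (\<Sum>a<L. cis (of_int d * (- 2 * pi * real a / real P)))"
      by (metis complex_norm_square)
    also have "\<dots> = (\<Sum>a<L. \<Sum>b<L. cis (of_int d * (- 2 * pi * (real a - real b) / real P)))"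
      unfolding cnj_sum cis_cnj sum_product cis_mult
      by (intro sum.cong refl arg_cong[of _ _ cis]) (use P in \<open>simp add: field_simps\<close>)
    finally show ?thesis
      by (simp add: r_def)
  qed
  have expand: "complex_of_real (hat Q L x)
      = (\<Sum>k\<in>{- int P..int P}. of_real (\<rho> k) * cis (of_int k * x))" for x
  proof -
    have "complex_of_real (hat Q L x)
        = (\<Sum>a<L. \<Sum>b<L. (\<Sum>p\<in>S. cis (of_int (int (fst p) - int (snd p)) * (x - 2 * pi * (real a - real b) / real P)))
              / (of_nat P)\<^sup>2) / of_nat L"
      unfolding hat_def S_def P_def
      by (simp add: fejer_expand sum.cartesian_product case_prod_unfold)
    also have "\<dots> = (\<Sum>a<L. \<Sum>b<L. \<Sum>p\<in>S. cis (of_int (int (fst p) - int (snd p)) * (x - 2 * pi * (real a - real b) / real P)))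
              / (of_nat L * (of_nat P)\<^sup>2)"
      by (simp add: sum_divide_distrib mult.commute)
    also have "(\<Sum>a<L. \<Sum>b<L. \<Sum>p\<in>S. cis (of_int (int (fst p) - int (snd p)) * (x - 2 * pi * (real a - real b) / real P)))
        = (\<Sum>a<L. \<Sum>p\<in>S. \<Sum>b<L. cis (of_int (int (fst p) - int (snd p)) * (x - 2 * pi * (real a - real b) / real P)))"
      by (intro sum.cong refl sum.swap)
    also have "\<dots> = (\<Sum>p\<in>S. \<Sum>a<L. \<Sum>b<L. cis (of_int (int (fst p) - int (snd p)) * (x - 2 * pi * (real a - real b) / real P)))"
      by (rule sum.swap)
    also have "\<dots> = (\<Sum>p\<in>S. (\<Sum>a<L. \<Sum>b<L. cis (of_int (int (fst p) - int (snd p)) * (- 2 * pi * (real a - real b) / real P)))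
           * cis (of_int (int (fst p) - int (snd p)) * x))"
      unfolding sum_distrib_right cis_mult
      by (intro sum.cong refl arg_cong[of _ _ cis]) (simp add: algebra_simps diff_divide_distrib add_divide_distrib)
    also have "\<dots> / (of_nat L * (of_nat P)\<^sup>2)
        = (\<Sum>p\<in>S. of_real (r (int (fst p) - int (snd p))) * cis (of_int (int (fst p) - int (snd p)) * x))"
      unfolding r_eq sum_divide_distrib[of _ S] by (intro sum.cong refl) simp
    also have "\<dots> = (\<Sum>k\<in>{- int P..int P}. \<Sum>p\<in>{p \<in> S. int (fst p) - int (snd p) = k}.
        of_real (r (int (fst p) - int (snd p))) * cis (of_int (int (fst p) - int (snd p)) * x))"
      by (rule sum.group[symmetric]) (auto simp: S_def)
    also have "\<dots> = (\<Sum>k\<in>{- int P..int P}. of_real (\<rho> k) * cis (of_int k * x))"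
      by (intro sum.cong refl) (simp add: \<rho>_def)
    finally show ?thesis .
  qed
  show thesis
  proof (rule that[of \<rho>])
    show "0 \<le> \<rho> k" for k
      by (simp add: \<rho>_def r_def)
    have "{p \<in> S. int (fst p) - int (snd p) = 0} = (\<lambda>k. (k, k)) ` {..<P}"
      by (auto simp: S_def)
    then have "card {p \<in> S. int (fst p) - int (snd p) = 0} = P"
      by (simp add: card_image inj_on_def)
    then have "\<rho> 0 = real P * ((real L)\<^sup>2 / (real L * (real P)\<^sup>2))"
      by (simp add: \<rho>_def r_def)
    also have "\<dots> = 1 / real Q"
      using assms by (simp add: P_def power2_eq_square field_simps)
    finally show "\<rho> 0 = 1 / real Q" .
    have "complex_of_real (hat Q L 0) = of_real (\<Sum>k\<in>{- int P..int P}. \<rho> k)"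
      using expand[of 0] by simp
    then have "(\<Sum>k\<in>{- int P..int P}. \<rho> k) = hat Q L (0 - 2 * pi * real 0 / real Q)"
      by (simp only: of_real_eq_iff) simp
    also have "\<dots> \<le> (\<Sum>q<Q. hat Q L (0 - 2 * pi * real q / real Q))"
      by (rule member_le_sum) (use assms in \<open>auto simp: hat_nonneg\<close>)
    also have "\<dots> = 1"
      by (rule hat_partition[OF assms])
    finally show "(\<Sum>k\<in>{- int (L * Q)..int (L * Q)}. \<rho> k) \<le> 1"
      by (simp add: P_def)
    show "complex_of_real (hat Q L x)
       = (\<Sum>k\<in>{- int (L * Q)..int (L * Q)}. of_real (\<rho> k) * cis (of_int k * x))" for x
      using expand by (simp add: P_def)
  qed
qed

section \<open>Counting nearby roots of unity\<close>

lemma sin_ge_half: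
  fixes y :: real
  assumes "0 \<le> y" "y \<le> pi / 2"
  shows "y / 2 \<le> sin y"
proof -
  have "y ^ 2 \<le> 3"
  proof -
    have "y \<le> 1.6" using assms pi_less_4 pi_approx by simp
    then have "y ^ 2 \<le> 1.6 ^ 2" using assms by (intro power_mono) auto
    then show ?thesis by (simp add: power2_eq_square)
  qed
  have "\<bar>sin y - y\<bar> \<le> \<bar>y\<bar> ^ 3 / 6"
    using Maclaurin_sin_bound[of y 3] by (simp add: eval_nat_numeral sin_coeff_def fact_numeral)
  moreover have "\<bar>y\<bar> ^ 3 = y * y ^ 2"
    using assms by (simp add: eval_nat_numeral)
  moreover have "y * y ^ 2 \<le> y * 3"
    using \<open>y ^ 2 \<le> 3\<close> assms by (intro mult_left_mono)
  ultimately show ?thesis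
    by linarith
qed

text \<open>
  The constant is absolute: any two such roots differ by a chord below \<open>8 * pi / Q\<close>, so their
  indices differ by at most \<open>7\<close> modulo \<open>Q\<close>. The count bounds the number of hat functions that
  are active at one point as well as the number of translates of a thin exceptional set that
  contain one point.
\<close>

lemma card_near_roots_le:
  assumes "0 < Q"
  shows "card {q. q < Q \<and> cmod (cis x - cis (2 * pi * real q / real Q)) < 4 * pi / real Q} \<le> 15"
proof (cases "{q. q < Q \<and> cmod (cis x - cis (2 * pi * real q / real Q)) < 4 * pi / real Q} = {}")
  case False
  define S where "S = {q. q < Q \<and> cmod (cis x - cis (2 * pi * real q / real Q)) < 4 * pi / real Q}"
  have fin: "finite S" by (simp add: S_def)
  define m where "m = Min S"
  have m: "m \<in> S" using fin False unfolding m_def S_def[symmetric] by (rule Min_in)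
  \<comment> \<open>Measured from the least index, the others lie in a short block after it or, going round the
    circle, in a short block before it.\<close>
  have "S \<subseteq> {m..m+7} \<union> {Q + m - 7..<Q + m}"
  proof
    fix q assume q: "q \<in> S"
    then have mq: "m \<le> q" "q < Q" using fin by (auto simp: m_def S_def)
    define d where "d = q - m"
    define y where "y = pi * real d / real Q"
    have "cmod (cis (2 * pi * real q / real Q) - cis (2 * pi * real m / real Q)) < 8 * pi / real Q"
      using q m norm_triangle_ineq4[of "cis x - cis (2 * pi * real m / real Q)" "cis x - cis (2 * pi * real q / real Q)"]
      by (simp add: S_def)
    moreover have "2 * pi * real q / real Q - 2 * pi * real m / real Q = 2 * y"
      using mq by (simp add: y_def d_def field_simps)
    ultimately have "cmod (cis (2 * y) - 1) < 8 * pi / real Q"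
      by (simp only: norm_cis_diff[symmetric])
    then have lt: "2 * \<bar>sin y\<bar> < 8 * pi / real Q"
      using dist_exp_i_1[of "2 * y"] by (simp add: cis_conv_exp)
    have piQ: "pi * (real d / real Q) = y" by (simp add: y_def)
    show "q \<in> {m..m+7} \<union> {Q + m - 7..<Q + m}"
    proof (cases "y \<le> pi / 2")
      case True
      moreover have "0 \<le> y" by (simp add: y_def)
      ultimately have "y / 2 \<le> sin y" by (intro sin_ge_half)
      then have "y < 8 * pi / real Q" using lt by linarith
      then have "d < 8" using assms by (simp add: y_def field_simps)
      then show ?thesis using mq by (auto simp: d_def)
    next
      case False
      have "real d < real Q" using mq by (simp add: d_def)
      then have "y \<le> pi" using assms by (simp add: y_def field_simps)
      then have "(pi - y) / 2 \<le> sin (pi - y)" using False by (intro sin_ge_half) auto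
      then have "pi - y < 8 * pi / real Q" using lt by (simp)
      then have "(pi - y) * real Q < 8 * pi" using assms by (subst (asm) pos_less_divide_eq) auto
      then have "pi * (real Q - d) < pi * 8" using assms by (simp add: y_def algebra_simps)
      then have "real Q - d < 8" by (subst (asm) mult_less_cancel_left_pos) auto
      then show ?thesis using mq by (auto simp: d_def)
    qed
  qed
  then have "card S \<le> card ({m..m+7} \<union> {Q + m - 7..<Q + m})"
    by (intro card_mono) auto
  also have "\<dots> \<le> card {m..m+7} + card {Q + m - 7..<Q + m}" by (rule card_Un_le)
  also have "\<dots> \<le> 15" by simp
  finally show ?thesis by (simp add: S_def)
next
  case True
  show ?thesis unfolding True by simp
qed

section \<open>Fourier partial sums of trigonometric polynomials\<close>

lemma integral_cis:
  "(LINT t:{0..2*pi}|lborel. cis (of_int m * t)) = (if m = 0 then 2 * of_real pi else 0)"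
proof (cases "m = 0")
  case True
  then show ?thesis
    by (simp add: set_lebesgue_integral_def scaleR_conv_of_real)
next
  case False
  let ?F = "\<lambda>z::complex. exp (\<i> * of_int m * z) / (\<i> * of_int m)"
  have "((\<lambda>t. ?F (of_real t)) has_vector_derivative cis (of_int m * t)) (at t within {0..2*pi})" for t
  proof (rule has_vector_derivative_real_field)
    show "(?F has_field_derivative cis (of_int m * t)) (at (of_real t))"
      using False by (auto intro!: derivative_eq_intros simp: cis_conv_exp mult_ac)
  qed
  then have "(\<integral>t. indicator {0..2*pi} t *\<^sub>R cis (of_int m * t) \<partial>lborel) = ?F (of_real (2 * pi)) - ?F (of_real 0)"
    by (intro integral_FTC_atLeastAtMost) (auto intro!: continuous_intros)
  also have "exp (\<i> * of_int m * of_real (2 * pi)) = 1"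
    using cis_multiple_2pi[of "of_int m"] by (simp add: cis_conv_exp mult_ac)
  then have "?F (of_real (2 * pi)) - ?F (of_real 0) = 0"
    by simp
  finally show ?thesis
    using False by (simp add: set_lebesgue_integral_def)
qed

lemma set_integral_sum:
  fixes f :: "_ \<Rightarrow> _ \<Rightarrow> 'a::{banach, second_countable_topology}"
  assumes "\<And>i. i \<in> I \<Longrightarrow> set_integrable M A (f i)"
  shows "(LINT x:A|M. (\<Sum>i\<in>I. f i x)) = (\<Sum>i\<in>I. LINT x:A|M. f i x)"
  using assms unfolding set_lebesgue_integral_def set_integrable_def
  by (simp add: scaleR_sum_right Bochner_Integration.integral_sum)

text \<open>
  The frequencies \<open>\<nu> i\<close> may repeat, so that a product of trigonometric polynomials can be
  expanded over pairs of frequencies without collecting equal ones.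
\<close>

lemma fourier_coeff_trig_sum:
  assumes "finite I"
    and g: "\<And>t. complex_of_real (g t) = (\<Sum>i\<in>I. \<alpha> i * cis (of_int (\<nu> i) * t))"
  shows "fourier_coeff g k = (\<Sum>i\<in>I. if \<nu> i = k then \<alpha> i else 0)"
proof -
  have int: "set_integrable lborel {0..2*pi} (\<lambda>t. \<alpha> i * cis (of_int m * t))" for i m
    by (intro borel_integrable_atLeastAtMost' continuous_intros)
  have "of_real (g t) * exp (- (\<i> * of_int k * of_real t)) = (\<Sum>i\<in>I. \<alpha> i * cis (of_int (\<nu> i - k) * t))" for t
    unfolding g sum_distrib_right
    by (intro sum.cong refl) (simp add: cis_conv_exp mult_exp_exp algebra_simps)
  then have "(LINT t:{0..2*pi}|lborel. of_real (g t) * exp (- (\<i> * of_int k * of_real t)))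
      = (\<Sum>i\<in>I. LINT t:{0..2*pi}|lborel. \<alpha> i * cis (of_int (\<nu> i - k) * t))"
    by (simp only: set_integral_sum[OF int])
  also have "\<dots> = (\<Sum>i\<in>I. \<alpha> i * (if \<nu> i - k = 0 then 2 * of_real pi else 0))"
    by (simp only: set_integral_mult_right integral_cis)
  finally show ?thesis
    by (simp add: fourier_coeff_def sum_distrib_left sum_divide_distrib if_distrib cong: if_cong)
qed

lemma fourier_partial_sum_trig_sum:
  assumes "finite I"
    and g: "\<And>t. complex_of_real (g t) = (\<Sum>i\<in>I. \<alpha> i * cis (of_int (\<nu> i) * t))"
  shows "fourier_partial_sum g N x = (\<Sum>i\<in>I. if \<bar>\<nu> i\<bar> \<le> int N then \<alpha> i * cis (of_int (\<nu> i) * x) else 0)"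
proof -
  have "fourier_partial_sum g N x
      = (\<Sum>k\<in>{- int N..int N}. \<Sum>i\<in>I. if k = \<nu> i then \<alpha> i * cis (of_int (\<nu> i) * x) else 0)"
    unfolding fourier_partial_sum_def fourier_coeff_trig_sum[OF assms] sum_distrib_right
    by (intro sum.cong refl) (auto simp: cis_conv_exp mult_ac)
  also have "\<dots> = (\<Sum>i\<in>I. \<Sum>k\<in>{- int N..int N}. if k = \<nu> i then \<alpha> i * cis (of_int (\<nu> i) * x) else 0)"
    by (rule sum.swap)
  also have "\<dots> = (\<Sum>i\<in>I. if \<bar>\<nu> i\<bar> \<le> int N then \<alpha> i * cis (of_int (\<nu> i) * x) else 0)"
    by (intro sum.cong refl) (subst sum.delta, auto)
  finally show ?thesis .
qed

lemma set_integrable_fourier: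
  assumes "continuous_on {0..2*pi} g"
  shows "set_integrable lborel {0..2*pi} (\<lambda>t. complex_of_real (g t) * exp (- (\<i> * of_int k * of_real t)))"
  by (intro borel_integrable_atLeastAtMost' continuous_intros assms)

lemma fourier_partial_sum_diff:
  assumes "continuous_on {0..2*pi} g" "continuous_on {0..2*pi} h"
  shows "fourier_partial_sum (\<lambda>t. g t - h t) N x = fourier_partial_sum g N x - fourier_partial_sum h N x"
proof -
  have "fourier_coeff (\<lambda>t. g t - h t) k = fourier_coeff g k - fourier_coeff h k" for k
    unfolding fourier_coeff_def right_diff_distrib[symmetric] of_real_diff left_diff_distrib
    by (subst set_integral_diff) (use assms in \<open>auto intro!: set_integrable_fourier\<close>)
  then show ?thesis
    by (simp add: fourier_partial_sum_def left_diff_distrib sum_subtractf)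
qed

lemma fourier_partial_sum_sum:
  assumes "finite I" "\<And>i. i \<in> I \<Longrightarrow> continuous_on {0..2*pi} (g i)"
  shows "fourier_partial_sum (\<lambda>t. \<Sum>i\<in>I. g i t) N x = (\<Sum>i\<in>I. fourier_partial_sum (g i) N x)"
proof -
  have "fourier_coeff (\<lambda>t. \<Sum>i\<in>I. g i t) k = (\<Sum>i\<in>I. fourier_coeff (g i) k)" for k
    unfolding fourier_coeff_def sum_distrib_left[symmetric] of_real_sum sum_distrib_right
    by (subst set_integral_sum) (use assms in \<open>auto intro!: set_integrable_fourier\<close>)
  then show ?thesis
    by (simp add: fourier_partial_sum_def sum_distrib_right sum.swap[of _ I])
qed

text \<open>
  The factor growing with \<open>N\<close> is harmless: the bound is used only for a fixed \<open>N\<close> and a function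
  that tends to \<open>0\<close> uniformly.
\<close>

lemma norm_fourier_partial_sum_le:
  assumes g: "continuous_on {0..2*pi} g" and B: "\<And>t. \<bar>g t\<bar> \<le> B"
  shows "cmod (fourier_partial_sum g N x) \<le> (2 * real N + 1) * B"
proof -
  have "cmod (fourier_coeff g k) \<le> B" for k
  proof -
    let ?u = "\<lambda>t. complex_of_real (g t) * exp (- (\<i> * of_int k * of_real t))"
    have norm_u: "cmod (?u t) = \<bar>g t\<bar>" for t
      by (simp add: norm_mult norm_exp_eq_Re)
    have "cmod (LINT t:{0..2*pi}|lborel. ?u t) \<le> (LINT t:{0..2*pi}|lborel. cmod (?u t))"
      by (rule set_integral_norm_bound[OF set_integrable_fourier[OF g]])
    also have "\<dots> \<le> (LINT t:{0..2*pi}|lborel. B)"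
      unfolding norm_u
      by (intro set_integral_mono borel_integrable_atLeastAtMost' continuous_intros g B)
    also have "\<dots> = 2 * pi * B"
      by (simp add: set_lebesgue_integral_def)
    finally show ?thesis
      by (simp add: fourier_coeff_def norm_mult norm_divide field_simps)
  qed
  then have "cmod (fourier_partial_sum g N x) \<le> (\<Sum>k\<in>{- int N..int N}. B)"
    unfolding fourier_partial_sum_def
    by (intro sum_norm_le) (simp add: norm_mult norm_exp_eq_Re)
  then show ?thesis
    by (simp add: algebra_simps)
qed

text \<open>
  The \<open>q\<close>-th summand has its frequencies within \<open>D\<close> of nonzero multiples of \<open>n q\<close>, up to \<open>K * n q\<close>.
  Since the \<open>n q\<close> grow fast, these frequency ranges are disjoint, and a given \<open>N\<close> cuts through at most
  one of them. The summands below the cut are complete, those above it vanish, and the one that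
  is cut is bounded by the absolute sum of its coefficients.
\<close>

lemma lacunary_partial_sums:
  fixes a b :: "nat \<Rightarrow> int \<Rightarrow> complex" and n :: "nat \<Rightarrow> nat" and D K m :: nat and g :: "real \<Rightarrow> real"
  defines "A \<equiv> \<lambda>q x. \<Sum>k\<in>{- int D..int D}. a q k * cis (of_int k * x)"
    and "B \<equiv> \<lambda>q x. \<Sum>l\<in>{- int K..int K}. b q l * cis (of_int l * x)"
  assumes g: "\<And>x. complex_of_real (g x) = (\<Sum>q<m. A q x * B q (real (n q) * x))"
    and lac: "\<And>p q. p < q \<Longrightarrow> q < m \<Longrightarrow> K * n p + 2 * D < n q"
    and mean: "\<And>q. q < m \<Longrightarrow> b q 0 = 0"
    and a: "\<And>q. q < m \<Longrightarrow> (\<Sum>k\<in>{- int D..int D}. cmod (a q k)) \<le> \<alpha>"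
    and b: "\<And>q. q < m \<Longrightarrow> (\<Sum>l\<in>{- int K..int K}. cmod (b q l)) \<le> \<beta>"
    and nonneg: "0 \<le> \<alpha>" "0 \<le> \<beta>"
    and sup: "\<And>x. (\<Sum>q<m. cmod (A q x) * cmod (B q (real (n q) * x))) \<le> \<gamma>"
  shows "cmod (fourier_partial_sum g N x) \<le> \<gamma> + \<alpha> * \<beta>"
    and "\<exists>N0. \<forall>N\<ge>N0. \<forall>x. fourier_partial_sum g N x = of_real (g x)"
proof -
  let ?J = "{- int D..int D} \<times> {- int K..int K}"
  define u where "u q x p = a q (fst p) * b q (snd p) * cis (of_int (fst p + snd p * int (n q)) * x)"
    for q x and p :: "int \<times> int"
  define T where "T N q x = (\<Sum>p\<in>?J. if \<bar>fst p + snd p * int (n q)\<bar> \<le> int N then u q x p else 0)"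
    for N q x
  have AB: "A q x * B q (real (n q) * x) = (\<Sum>p\<in>?J. u q x p)" for q x
    unfolding A_def B_def sum_product sum.cartesian_product u_def
    by (intro sum.cong refl) (auto simp: cis_mult algebra_simps)
  have g': "complex_of_real (g x) = (\<Sum>i\<in>{..<m} \<times> ?J. (a (fst i) (fst (snd i)) * b (fst i) (snd (snd i)))
      * cis (of_int (fst (snd i) + snd (snd i) * int (n (fst i))) * x))" for x
    unfolding g AB u_def sum.cartesian_product by (simp add: case_prod_unfold)
  have S: "fourier_partial_sum g N x = (\<Sum>q<m. T N q x)" for N x
    unfolding T_def sum.cartesian_product u_def
    by (subst fourier_partial_sum_trig_sum[OF _ g']) (auto simp: case_prod_unfold intro!: sum.cong)
  have full: "T N q x = A q x * B q (real (n q) * x)" if "D + K * n q \<le> N" for N q x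
  proof -
    have "\<bar>k + l * int (n q)\<bar> \<le> int N" if "\<bar>k\<bar> \<le> int D" "\<bar>l\<bar> \<le> int K" for k l
    proof -
      have "\<bar>k + l * int (n q)\<bar> \<le> \<bar>k\<bar> + \<bar>l\<bar> * int (n q)"
        using abs_triangle_ineq[of k "l * int (n q)"] by (simp add: abs_mult)
      also have "\<dots> \<le> int D + int K * int (n q)"
        using that by (intro add_mono mult_right_mono) auto
      also have "\<dots> \<le> int N"
        using \<open>D + K * n q \<le> N\<close> by (metis of_nat_add of_nat_le_iff of_nat_mult)
      finally show ?thesis .
    qed
    then show ?thesis
      unfolding AB T_def by (intro sum.cong refl if_P) (auto simp: abs_le_iff)
  qed
  have zero: "T N q x = 0" if "N + D < n q" "q < m" for N q x
  proof -
    have "u q x p = 0" if "p \<in> ?J" and le: "\<bar>fst p + snd p * int (n q)\<bar> \<le> int N" for p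
    proof (cases "snd p = 0")
      case True
      then show ?thesis
        using mean[OF \<open>q < m\<close>] by (simp add: u_def)
    next
      case False
      then have "1 * int (n q) \<le> \<bar>snd p\<bar> * int (n q)"
        by (intro mult_right_mono) auto
      also have "\<dots> = \<bar>snd p * int (n q)\<bar>"
        by (simp add: abs_mult)
      also have "\<dots> \<le> \<bar>fst p + snd p * int (n q)\<bar> + \<bar>fst p\<bar>"
        by linarith
      also have "\<dots> \<le> int N + int D"
        using le that(1) by (intro add_mono) (auto simp: mem_Times_iff)
      finally show ?thesis
        using \<open>N + D < n q\<close> by linarith
    qed
    then show ?thesis
      unfolding T_def by (intro sum.neutral) auto
  qed
  have trivial: "cmod (T N q x) \<le> \<alpha> * \<beta>" if "q < m" for N q x
  proof -
    have "cmod (T N q x) \<le> (\<Sum>p\<in>?J. cmod (a q (fst p)) * cmod (b q (snd p)))"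
      unfolding T_def by (intro sum_norm_le) (auto simp: u_def norm_mult)
    also have "\<dots> = (\<Sum>k\<in>{- int D..int D}. cmod (a q k)) * (\<Sum>l\<in>{- int K..int K}. cmod (b q l))"
      unfolding sum_product sum.cartesian_product by (simp add: case_prod_unfold)
    also have "\<dots> \<le> \<alpha> * \<beta>"
      using a[OF that] b[OF that] nonneg by (intro mult_mono) (auto intro: sum_nonneg)
    finally show ?thesis .
  qed
  \<comment> \<open>The summands that are cut by \<open>N\<close>.\<close>
  define W where "W = {q. q < m \<and> N < D + K * n q \<and> n q \<le> N + D}"
  have "p = q" if "p \<in> W" "q \<in> W" for p q
  proof (rule ccontr)
    assume "p \<noteq> q"
    then consider "p < q" | "q < p"
      by linarith
    then show False
      using lac[of p q] lac[of q p] that by cases (auto simp: W_def)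
  qed
  moreover have finW: "finite W"
    by (simp add: W_def)
  ultimately have "card W \<le> 1"
    by (auto simp: card_le_Suc0_iff_eq)
  have "cmod (T N q x) \<le> cmod (A q x) * cmod (B q (real (n q) * x)) + (if q \<in> W then \<alpha> * \<beta> else 0)"
    if "q < m" for q
    using full[of q N x] zero[of N q x] trivial[of q N x] that
    by (cases "D + K * n q \<le> N"; cases "N + D < n q") (auto simp: W_def norm_mult add_increasing)
  then have "cmod (fourier_partial_sum g N x)
      \<le> (\<Sum>q<m. cmod (A q x) * cmod (B q (real (n q) * x)) + (if q \<in> W then \<alpha> * \<beta> else 0))"
    unfolding S by (intro sum_norm_le) auto
  also have "\<dots> = (\<Sum>q<m. cmod (A q x) * cmod (B q (real (n q) * x))) + real (card W) * (\<alpha> * \<beta>)"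
  proof -
    have "{..<m} \<inter> W = W"
      by (auto simp: W_def)
    then show ?thesis
      by (simp add: sum.distrib flip: sum.inter_restrict)
  qed
  also have "\<dots> \<le> \<gamma> + \<alpha> * \<beta>"
    using sup[of x] mult_right_mono[of "real (card W)" 1 "\<alpha> * \<beta>"] \<open>card W \<le> 1\<close> nonneg by simp
  finally show "cmod (fourier_partial_sum g N x) \<le> \<gamma> + \<alpha> * \<beta>" .
  have "\<forall>N\<ge>(\<Sum>q<m. D + K * n q). \<forall>x. fourier_partial_sum g N x = of_real (g x)"
  proof (intro allI impI)
    fix N x
    assume N: "(\<Sum>q<m. D + K * n q) \<le> N"
    have "D + K * n q \<le> N" if "q < m" for q
      using member_le_sum[of q "{..<m}" "\<lambda>q. D + K * n q"] that N by auto
    then show "fourier_partial_sum g N x = of_real (g x)"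
      unfolding S g by (intro sum.cong refl full) auto
  qed
  then show "\<exists>N0. \<forall>N\<ge>N0. \<forall>x. fourier_partial_sum g N x = of_real (g x)" ..
qed

section \<open>Approximate correction with bounded partial sums\<close>

lemma sum_measure_le_overlap:
  assumes "finite_measure M" "finite I" and E: "\<And>i. i \<in> I \<Longrightarrow> E i \<in> sets M" "\<And>i. i \<in> I \<Longrightarrow> E i \<subseteq> A"
    and A: "A \<in> sets M" and c: "\<And>x. x \<in> A \<Longrightarrow> card {i \<in> I. x \<in> E i} \<le> c"
  shows "(\<Sum>i\<in>I. measure M (E i)) \<le> real c * measure M A"
proof -
  interpret finite_measure M by fact
  have "(\<Sum>i\<in>I. measure M (E i)) = (\<Sum>i\<in>I. integral\<^sup>L M (indicator (E i)))"
    using E by (intro sum.cong refl) simp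
  also have "\<dots> = (\<integral>x. (\<Sum>i\<in>I. indicator (E i) x) \<partial>M)"
    using E by (subst Bochner_Integration.integral_sum) (auto simp: emeasure_eq_measure)
  also have "\<dots> \<le> (\<integral>x. real c * indicator A x \<partial>M)"
  proof (rule integral_mono)
    show "(\<Sum>i\<in>I. indicator (E i) x) \<le> real c * indicator A x" for x
    proof (cases "x \<in> A")
      case True
      have "(\<Sum>i\<in>I. indicat_real (E i) x) = real (card {i \<in> I. x \<in> E i})"
        using assms(2) by (simp add: indicator_def if_distrib sum.If_cases Int_def cong: if_cong)
      then show ?thesis
        using c[OF True] True by simp
    next
      case False
      then have "(\<Sum>i\<in>I. indicat_real (E i) x) = 0"
        using E(2) by (intro sum.neutral) (auto simp: indicator_def)
      then show ?thesis
        by simp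
    qed
  qed (use E A in \<open>auto simp: emeasure_eq_measure\<close>)
  also have "\<dots> = real c * measure M A"
    using A by simp
  finally show ?thesis .
qed

text \<open>
  Continuous periodic functions, represented on the compact unit circle so that uniform continuity
  with respect to the chord \<open>cmod (cis x - cis y)\<close> is immediate.
\<close>

definition circle_fun :: "(real \<Rightarrow> real) \<Rightarrow> bool" where
  "circle_fun f \<longleftrightarrow> (\<exists>F. continuous_on (sphere 0 1) F \<and> f = (\<lambda>x. F (cis x)))"

lemma circle_fun_uniform:
  assumes "circle_fun f" "0 < e"
  obtains d where "0 < d" "\<And>x y. cmod (cis x - cis y) < d \<Longrightarrow> \<bar>f x - f y\<bar> < e"
proof -
  obtain F where F: "continuous_on (sphere 0 1) F" "f = (\<lambda>x. F (cis x))"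
    using assms(1) by (auto simp: circle_fun_def)
  then have "uniformly_continuous_on (sphere 0 1) F"
    by (intro compact_uniformly_continuous compact_sphere)
  then obtain d where "0 < d"
    and d: "\<And>z w. z \<in> sphere 0 1 \<Longrightarrow> w \<in> sphere 0 1 \<Longrightarrow> dist w z < d \<Longrightarrow> dist (F w) (F z) < e"
    using assms(2) unfolding uniformly_continuous_on_def by metis
  show thesis
  proof (rule that[OF \<open>0 < d\<close>])
    show "\<bar>f x - f y\<bar> < e" if "cmod (cis x - cis y) < d" for x y
      using d[of "cis y" "cis x"] that F(2) by (simp add: dist_norm)
  qed
qed

lemma hat_le_1:
  assumes "0 < Q" "0 < L"
  shows "hat Q L x \<le> 1"
  using member_le_sum[of 0 "{..<Q}" "\<lambda>q. hat Q L (x - 2 * pi * real q / real Q)"]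
    hat_partition[OF assms, of x] assms by (simp add: hat_nonneg)

text \<open>
  Subtracting the multiple \<open>Q\<close> of a hat function from \<open>1\<close> gives mean value \<open>0\<close>, because the mean of the
  hat is \<open>1 / Q\<close>. The result is still almost \<open>1\<close> outside an arc of length comparable to \<open>1 / Q\<close>, and the bound
  on its coefficients depends only on \<open>Q\<close>, not on the accuracy \<open>1 / L\<close>.
\<close>

lemma mean_zero_correction_fourier:
  assumes "0 < Q" "0 < L"
  obtains b :: "int \<Rightarrow> complex" where "b 0 = 0"
    "(\<Sum>l\<in>{- int (L * Q)..int (L * Q)}. cmod (b l)) \<le> real Q"
    "\<And>x. complex_of_real (1 - real Q * hat Q L x)
       = (\<Sum>l\<in>{- int (L * Q)..int (L * Q)}. b l * cis (of_int l * x))"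
proof -
  let ?I = "{- int (L * Q)..int (L * Q)}"
  obtain \<rho> :: "int \<Rightarrow> real" where \<rho>: "\<And>k. 0 \<le> \<rho> k" "\<rho> 0 = 1 / real Q"
    "(\<Sum>k\<in>?I. \<rho> k) \<le> 1"
    "\<And>x. complex_of_real (hat Q L x) = (\<Sum>k\<in>?I. of_real (\<rho> k) * cis (of_int k * x))"
    using hat_fourier[OF assms] by blast
  define b where "b l = (if l = 0 then 0 else - complex_of_real (real Q * \<rho> l))" for l
  have "(\<Sum>l\<in>?I. cmod (b l)) \<le> (\<Sum>l\<in>?I. real Q * \<rho> l)"
    using \<rho>(1) by (intro sum_mono) (auto simp: b_def norm_mult)
  also have "\<dots> \<le> real Q"
    using mult_left_mono[OF \<rho>(3), of "real Q"] by (simp flip: sum_distrib_left)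
  finally have le: "(\<Sum>l\<in>?I. cmod (b l)) \<le> real Q" .
  have "complex_of_real (1 - real Q * hat Q L x) = (\<Sum>l\<in>?I. b l * cis (of_int l * x))" for x
  proof -
    have "(\<Sum>l\<in>?I. b l * cis (of_int l * x))
        = (\<Sum>l\<in>?I. (if l = 0 then 1 else 0) - of_real (real Q) * (of_real (\<rho> l) * cis (of_int l * x)))"
      by (intro sum.cong refl) (use assms \<rho>(2) in \<open>auto simp: b_def\<close>)
    also have "\<dots> = 1 - of_real (real Q) * of_real (hat Q L x)"
      unfolding sum_subtractf \<rho>(4) sum_distrib_left by simp
    finally show ?thesis
      by simp
  qed
  with le show thesis
    by (intro that[of b]) (auto simp: b_def)
qed

lemma positive_nat_ge:
  obtains n :: nat where "0 < n" "r \<le> real n"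
proof -
  obtain m :: nat where "r \<le> real m"
    using real_arch_simple by blast
  then show thesis
    by (intro that[of "Suc m"]) auto
qed

lemma cis_borel_measurable: "cis \<in> borel_measurable borel"
  by (intro borel_measurable_continuous_onI continuous_intros)

lemma near_set_measurable:
  assumes "(\<lambda>x. x) \<in> borel_measurable \<mu>"
  shows "{x \<in> space \<mu>. cmod (cis (c * x) - z) < t} \<in> sets \<mu>"
proof -
  have [measurable]: "(\<lambda>x. cis (c * x)) \<in> borel_measurable \<mu>"
    by (rule measurable_compose[OF _ cis_borel_measurable])
       (intro borel_measurable_times borel_measurable_const assms)
  show ?thesis
    by measurable
qed

text \<open>
  The function \<open>f\<close> is close to \<open>\<Sum>q. f (y q) * \<phi> (x - y q)\<close> for a fine partition of unity by hats \<open>\<phi>\<close>. In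
  each summand the constant \<open>1\<close> is replaced by \<open>\<psi> (n q * x - s q)\<close>, where \<open>\<psi>\<close> has mean \<open>0\<close> and is almost \<open>1\<close>
  outside a small arc. This pushes the summands into disjoint frequency ranges. For a general
  measure the exceptional set need not be small for every phase \<open>s q\<close>, but it is small on average
  over the phases, so a good phase exists. Near each point only boundedly many hats count, hence
  the exceptional sets add up to a small measure although there are many hats.
  
  It is essential that \<open>C\<close> does not depend on \<open>\<delta>\<close>: the accuracy of one correction can then be chosen
  in terms of the constant of the next one.
\<close>

lemma approximate_correction:
  fixes \<mu> :: "real measure"
  assumes \<mu>: "finite_measure \<mu>" and meas: "(\<lambda>x. x) \<in> borel_measurable \<mu>" and \<epsilon>: "0 < \<epsilon>"
  obtains C where "1 \<le> C"
    "\<And>\<delta> B f. 0 < \<delta> \<Longrightarrow> 0 < B \<Longrightarrow> circle_fun f \<Longrightarrow> (\<And>x. \<bar>f x\<bar> \<le> B) \<Longrightarrow>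
       \<exists>h A. (\<exists>N0. \<forall>N\<ge>N0. \<forall>x. fourier_partial_sum h N x = of_real (h x)) \<and>
           (\<forall>N x. cmod (fourier_partial_sum h N x) \<le> C * B) \<and>
           A \<in> sets \<mu> \<and> measure \<mu> A \<le> \<epsilon> \<and> (\<forall>x\<in>space \<mu> - A. \<bar>f x - h x\<bar> \<le> \<delta>)"
proof -
  interpret finite_measure \<mu> by fact
  define M where "M = measure \<mu> (space \<mu>)"
  \<comment> \<open>\<open>225\<close> is the square of the overlap bound \<open>15\<close>: one factor comes from the phases, the other one from
    the hats.\<close>
  obtain Q1 :: nat where Q1: "0 < Q1" "225 * M / \<epsilon> \<le> real Q1"
    using positive_nat_ge by blast
  show thesis
  proof (rule that[of "2 * real Q1"])
    show "1 \<le> 2 * real Q1"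
      using Q1 by simp
  next
    fix \<delta> B :: real and f :: "real \<Rightarrow> real"
    assume \<delta>: "0 < \<delta>" and B: "0 < B" and f: "circle_fun f" and fB: "\<And>x. \<bar>f x\<bar> \<le> B"
    obtain d where "0 < d" and d: "\<And>x y. cmod (cis x - cis y) < d \<Longrightarrow> \<bar>f x - f y\<bar> < \<delta> / 4"
      using circle_fun_uniform[OF f, of "\<delta> / 4"] \<delta> by auto
    obtain Q2 :: nat where Q2: "0 < Q2" "4 * pi / d \<le> real Q2"
      using positive_nat_ge by blast
    have Q2d: "4 * pi / real Q2 \<le> d"
      using Q2 \<open>0 < d\<close> by (simp add: field_simps)
    obtain L1 :: nat where L1: "0 < L1" "4 * B * real Q1 / \<delta> \<le> real L1"
      using positive_nat_ge by blast
    have L1': "B * (real Q1 * (1 / real L1)) \<le> \<delta> / 4"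
    proof -
      have "4 * B * real Q1 \<le> real L1 * \<delta>"
        using L1(2) \<delta> by (simp only: pos_divide_le_eq)
      then have "B * real Q1 / real L1 \<le> \<delta> / 4"
        using L1(1) by (subst pos_divide_le_eq) (simp_all add: mult_ac)
      then show ?thesis by simp
    qed
    obtain L2 :: nat where L2: "0 < L2" "2 * real Q2 * (B * (1 + real Q1)) / \<delta> \<le> real L2"
      using positive_nat_ge by blast
    have L2': "real Q2 * (1 / real L2 * (B * (1 + real Q1))) \<le> \<delta> / 2"
    proof -
      have "2 * real Q2 * (B * (1 + real Q1)) \<le> real L2 * \<delta>"
        using L2(2) \<delta> by (simp only: pos_divide_le_eq)
      then have "real Q2 * (B * (1 + real Q1)) / real L2 \<le> \<delta> / 2"
        using L2(1) by (subst pos_divide_le_eq) (simp_all add: mult_ac)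
      then show ?thesis by simp
    qed
    define \<phi> where "\<phi> = hat Q2 L2"
    define \<psi> where "\<psi> x = 1 - real Q1 * hat Q1 L1 x" for x
    define D where "D = L2 * Q2"
    define K where "K = L1 * Q1"
    obtain \<rho> :: "int \<Rightarrow> real" where \<rho>: "\<And>k. 0 \<le> \<rho> k" "(\<Sum>k\<in>{- int D..int D}. \<rho> k) \<le> 1"
      "\<And>x. complex_of_real (\<phi> x) = (\<Sum>k\<in>{- int D..int D}. of_real (\<rho> k) * cis (of_int k * x))"
      by (rule hat_fourier[OF Q2(1) L2(1), folded D_def \<phi>_def]) (rule that)
    obtain b :: "int \<Rightarrow> complex" where b: "b 0 = 0" "(\<Sum>l\<in>{- int K..int K}. cmod (b l)) \<le> real Q1"
      "\<And>x. complex_of_real (\<psi> x) = (\<Sum>l\<in>{- int K..int K}. b l * cis (of_int l * x))"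
      by (rule mean_zero_correction_fourier[OF Q1(1) L1(1), folded K_def \<psi>_def]) (rule that)
    have \<phi>: "0 \<le> \<phi> x" "(\<Sum>q<Q2. \<phi> (x - 2 * pi * real q / real Q2)) = 1" for x
      using hat_partition[OF Q2(1) L2(1), of x] by (simp_all add: \<phi>_def hat_nonneg)
    have \<psi>_le: "\<bar>\<psi> x\<bar> \<le> real Q1" for x
    proof -
      have "0 \<le> real Q1 * hat Q1 L1 x" "real Q1 * hat Q1 L1 x \<le> real Q1"
        using hat_le_1[OF Q1(1) L1(1), of x] by (simp_all add: hat_nonneg mult_left_le)
      then show ?thesis
        using Q1(1) unfolding \<psi>_def by linarith
    qed
    define n where "n q = (K + 2 * D + 1) ^ Suc q" for q :: nat
    define y where "y q = 2 * pi * real q / real Q2" for q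
    define A where "A q = {x \<in> space \<mu>. cmod (cis (1 * x) - cis (y q)) < 4 * pi / real Q2}" for q
    define E where "E q r = A q \<inter> {x \<in> space \<mu>. cmod (cis (real (n q) * x) - cis (2 * pi * real r / real Q1)) < 4 * pi / real Q1}" for q r
    have A_meas: "A q \<in> sets \<mu>" for q
      unfolding A_def by (rule near_set_measurable[OF meas])
    have E_meas: "E q r \<in> sets \<mu>" for q r
      unfolding E_def by (intro sets.Int A_meas near_set_measurable[OF meas])
    \<comment> \<open>The phases \<open>2 * pi * r / Q1\<close> give exceptional sets of overlap at most \<open>15\<close> within \<open>A q\<close>; the smallest
      of them has at most the average measure.\<close>
    have "\<exists>r<Q1. measure \<mu> (E q r) \<le> 15 * measure \<mu> (A q) / real Q1" for q
    proof (rule ccontr)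
      assume "\<not> ?thesis"
      then have "(\<Sum>r<Q1. 15 * measure \<mu> (A q) / real Q1) < (\<Sum>r<Q1. measure \<mu> (E q r))"
        using Q1(1) by (intro sum_strict_mono) (auto simp: not_le)
      moreover have "(\<Sum>r<Q1. measure \<mu> (E q r)) \<le> real 15 * measure \<mu> (A q)"
      proof (rule sum_measure_le_overlap[OF \<mu> _ E_meas _ A_meas])
        show "card {r \<in> {..<Q1}. x \<in> E q r} \<le> 15" for x
          using card_near_roots_le[OF Q1(1), of "real (n q) * x"]
          by (rule order_trans[rotated]) (auto intro!: card_mono simp: E_def)
      qed (auto simp: E_def)
      ultimately show False
        using Q1(1) by simp
    qed
    then obtain r where r: "\<And>q. measure \<mu> (E q (r q)) \<le> 15 * measure \<mu> (A q) / real Q1"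
      by metis
    define s where "s q = 2 * pi * real (r q) / real Q1" for q
    define h where "h x = (\<Sum>q<Q2. f (y q) * \<phi> (x - y q) * \<psi> (real (n q) * x - s q))" for x
    define a' where "a' q k = complex_of_real (f (y q) * \<rho> k) * cis (- (of_int k * y q))" for q k
    define b' where "b' q l = b l * cis (- (of_int l * s q))" for q l
    have a'_eq: "(\<Sum>k\<in>{- int D..int D}. a' q k * cis (of_int k * x)) = of_real (f (y q) * \<phi> (x - y q))" for q x
      unfolding of_real_mult \<rho>(3) a'_def sum_distrib_left
      by (intro sum.cong refl) (simp add: cis_mult algebra_simps)
    have b'_eq: "(\<Sum>l\<in>{- int K..int K}. b' q l * cis (of_int l * x)) = of_real (\<psi> (x - s q))" for q x
      unfolding b(3) b'_def by (intro sum.cong refl) (simp add: cis_mult algebra_simps)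
    have b'_0: "b' q 0 = 0" for q
      by (simp add: b'_def b(1))
    \<comment> \<open>The powers of \<open>K + 2 * D + 1\<close> are just sparse enough.\<close>
    have lac: "K * n p + 2 * D < n q" if "p < q" for p q
    proof -
      have "1 \<le> n p"
        unfolding n_def by (rule one_le_power) simp
      then have "2 * D < (2 * D + 1) * n p"
        by (intro less_le_trans[OF _ mult_le_mono2[of 1 "n p" "2 * D + 1"]]) simp_all
      then have "K * n p + 2 * D < (K + 2 * D + 1) * n p"
        by (simp add: algebra_simps)
      also have "\<dots> = n (Suc p)"
        by (simp add: n_def)
      also have "\<dots> \<le> n q"
        unfolding n_def using that by (intro power_increasing) auto
      finally show ?thesis .
    qed
    have sum_a: "(\<Sum>k\<in>{- int D..int D}. cmod (a' q k)) \<le> B" for q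
    proof -
      have "(\<Sum>k\<in>{- int D..int D}. cmod (a' q k)) = \<bar>f (y q)\<bar> * (\<Sum>k\<in>{- int D..int D}. \<rho> k)"
        using \<rho>(1) by (simp add: a'_def norm_mult abs_mult sum_distrib_left)
      also have "\<dots> \<le> B * 1"
        using fB B \<rho> by (intro mult_mono) (auto intro: sum_nonneg)
      finally show ?thesis by simp
    qed
    have sum_b: "(\<Sum>l\<in>{- int K..int K}. cmod (b' q l)) \<le> real Q1" for q
      using b(2) by (simp add: b'_def norm_mult)
    have sup: "(\<Sum>q<Q2. \<bar>f (y q) * \<phi> (x - y q)\<bar> * \<bar>\<psi> (real (n q) * x - s q)\<bar>) \<le> B * real Q1" for x
    proof -
      have "(\<Sum>q<Q2. \<bar>f (y q) * \<phi> (x - y q)\<bar> * \<bar>\<psi> (real (n q) * x - s q)\<bar>)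
          \<le> (\<Sum>q<Q2. B * \<phi> (x - y q) * real Q1)"
        using fB B \<phi>(1) \<psi>_le by (intro sum_mono mult_mono) (auto simp: abs_mult intro!: mult_right_mono)
      also have "\<dots> = B * real Q1"
        using \<phi>(2)[of x] by (simp add: y_def mult_ac flip: sum_distrib_left)
      finally show ?thesis .
    qed
    have h_eq: "complex_of_real (h x) = (\<Sum>q<Q2. (\<Sum>k\<in>{- int D..int D}. a' q k * cis (of_int k * x)) *
        (\<Sum>l\<in>{- int K..int K}. b' q l * cis (of_int l * (real (n q) * x))))" for x
      unfolding a'_eq b'_eq by (simp add: h_def)
    have bound: "cmod (fourier_partial_sum h N x) \<le> B * real Q1 + B * real Q1" for N x
      by (rule lacunary_partial_sums(1)[OF h_eq lac _ sum_a sum_b])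
         (use sup B b'_0 in \<open>simp_all add: a'_eq b'_eq del: of_real_mult\<close>)
    have stable: "\<exists>N0. \<forall>N\<ge>N0. \<forall>x. fourier_partial_sum h N x = of_real (h x)"
      by (rule lacunary_partial_sums(2)[where \<gamma> = "B * real Q1", OF h_eq lac _ sum_a sum_b])
         (use sup B b'_0 in \<open>simp_all add: a'_eq b'_eq del: of_real_mult\<close>)
    define Bad where "Bad = (\<Union>q<Q2. E q (r q))"
    have "measure \<mu> Bad \<le> (\<Sum>q<Q2. measure \<mu> (E q (r q)))"
      unfolding Bad_def by (intro measure_UNION_le) (auto intro: E_meas)
    also have "\<dots> \<le> (\<Sum>q<Q2. 15 * measure \<mu> (A q) / real Q1)"
      by (intro sum_mono r)
    also have "\<dots> = 15 / real Q1 * (\<Sum>q<Q2. measure \<mu> (A q))"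
      by (simp add: sum_distrib_left)
    also have "\<dots> \<le> 15 / real Q1 * (real 15 * M)"
      unfolding M_def
    proof (intro mult_left_mono sum_measure_le_overlap[OF \<mu> _ A_meas])
      show "card {q \<in> {..<Q2}. x \<in> A q} \<le> 15" for x
        using card_near_roots_le[OF Q2(1), of x]
        by (rule order_trans[rotated]) (auto intro!: card_mono simp: A_def y_def)
    qed (auto simp: A_def)
    also have "\<dots> \<le> \<epsilon>"
      using Q1 \<epsilon> by (simp add: field_simps)
    finally have Bad_le: "measure \<mu> Bad \<le> \<epsilon>" .
    have close: "\<bar>f x - h x\<bar> \<le> \<delta>" if x: "x \<in> space \<mu> - Bad" for x
    proof -
      define v where "v q = f x - f (y q) * \<psi> (real (n q) * x - s q)" for q
      have "f x - h x = (\<Sum>q<Q2. \<phi> (x - y q)) * f x - h x"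
        using \<phi>(2)[of x] by (simp add: y_def)
      also have "\<dots> = (\<Sum>q<Q2. \<phi> (x - y q) * v q)"
        unfolding h_def v_def sum_distrib_right sum_subtractf[symmetric]
        by (intro sum.cong refl) (simp add: algebra_simps)
      finally have "f x - h x = (\<Sum>q<Q2. \<phi> (x - y q) * v q)" .
      moreover have "\<bar>\<phi> (x - y q) * v q\<bar> \<le> \<phi> (x - y q) * (\<delta> / 2) + 1 / real L2 * (B * (1 + real Q1))"
        if "q < Q2" for q
      \<comment> \<open>If \<open>y q\<close> is near \<open>x\<close>, then \<open>v q\<close> is small because \<open>\<psi>\<close> is almost \<open>1\<close> there; otherwise \<open>\<phi>\<close> is small.\<close>
      proof (cases "cmod (cis x - cis (y q)) < 4 * pi / real Q2")
        case True
        have "x \<notin> E q (r q)"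
          using x that by (auto simp: Bad_def)
        then have "4 * pi / real Q1 \<le> cmod (cis (real (n q) * x - s q) - 1)"
          using True x by (auto simp: E_def A_def s_def norm_cis_diff)
        then have "hat Q1 L1 (real (n q) * x - s q) \<le> 1 / real L1"
          by (rule hat_tail[OF Q1(1) L1(1)])
        then have "\<bar>f (y q)\<bar> * (real Q1 * hat Q1 L1 (real (n q) * x - s q)) \<le> B * (real Q1 * (1 / real L1))"
          using fB B by (intro mult_mono) (auto simp: hat_nonneg)
        then have 1: "\<bar>f (y q) * (real Q1 * hat Q1 L1 (real (n q) * x - s q))\<bar> \<le> \<delta> / 4"
          using L1' unfolding abs_mult[of "f (y q)"] by (simp only: abs_of_nonneg mult_nonneg_nonneg of_nat_0_le_iff hat_nonneg)
        have 2: "\<bar>f x - f (y q)\<bar> < \<delta> / 4"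
          using True Q2d by (intro d) linarith
        have "v q = (f x - f (y q)) + f (y q) * (real Q1 * hat Q1 L1 (real (n q) * x - s q))"
          by (simp add: v_def \<psi>_def algebra_simps)
        then have "\<bar>v q\<bar> \<le> \<delta> / 2"
          using 1 2 by linarith
        then have "\<bar>\<phi> (x - y q) * v q\<bar> \<le> \<phi> (x - y q) * (\<delta> / 2)"
          unfolding abs_mult abs_of_nonneg[OF \<phi>(1)] by (intro mult_left_mono \<phi>(1))
        moreover have "0 \<le> 1 / real L2 * (B * (1 + real Q1))"
          using B by simp
        ultimately show ?thesis by linarith
      next
        case False
        then have "\<phi> (x - y q) \<le> 1 / real L2"
          unfolding \<phi>_def by (intro hat_tail[OF Q2(1) L2(1)]) (simp add: norm_cis_diff)
        moreover have "\<bar>v q\<bar> \<le> B * (1 + real Q1)"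
        proof -
          have "\<bar>f (y q) * \<psi> (real (n q) * x - s q)\<bar> \<le> B * real Q1"
            unfolding abs_mult using fB B \<psi>_le by (intro mult_mono) auto
          then show ?thesis
            using fB[of x] by (simp add: v_def algebra_simps)
        qed
        ultimately have "\<bar>\<phi> (x - y q) * v q\<bar> \<le> 1 / real L2 * (B * (1 + real Q1))"
          unfolding abs_mult using \<phi>(1)[of "x - y q"] by (intro mult_mono) auto
        moreover have "0 \<le> \<phi> (x - y q) * (\<delta> / 2)"
          using \<phi>(1) \<delta> by simp
        ultimately show ?thesis by linarith
      qed
      ultimately have "\<bar>f x - h x\<bar> \<le> (\<Sum>q<Q2. \<phi> (x - y q) * (\<delta> / 2) + 1 / real L2 * (B * (1 + real Q1)))"
        by (simp only:) (intro order_trans[OF sum_abs] sum_mono, auto)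
      also have "\<dots> = (\<Sum>q<Q2. \<phi> (x - y q)) * (\<delta> / 2) + real Q2 * (1 / real L2 * (B * (1 + real Q1)))"
        by (simp only: sum.distrib sum_distrib_right) simp
      also have "(\<Sum>q<Q2. \<phi> (x - y q)) = 1"
        using \<phi>(2)[of x] by (simp add: y_def)
      finally show ?thesis
        using L2' by linarith
    qed
    have "Bad \<in> sets \<mu>"
      unfolding Bad_def by (intro sets.finite_UN E_meas) auto
    then show "\<exists>h A. (\<exists>N0. \<forall>N\<ge>N0. \<forall>x. fourier_partial_sum h N x = of_real (h x)) \<and>
           (\<forall>N x. cmod (fourier_partial_sum h N x) \<le> 2 * real Q1 * B) \<and>
           A \<in> sets \<mu> \<and> measure \<mu> A \<le> \<epsilon> \<and> (\<forall>x\<in>space \<mu> - A. \<bar>f x - h x\<bar> \<le> \<delta>)"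
      using bound stable Bad_le close
      by (intro exI[of _ h] exI[of _ Bad]) (auto simp: algebra_simps)
  qed
qed

section \<open>Summing the corrections\<close>

lemma stable_imp_circle_fun:
  assumes "\<exists>N0. \<forall>N\<ge>N0. \<forall>x. fourier_partial_sum h N x = complex_of_real (h x)"
  shows "circle_fun h"
proof -
  obtain N where N: "\<And>x. fourier_partial_sum h N x = complex_of_real (h x)"
    using assms by blast
  define F where "F z = Re (\<Sum>k\<in>{- int N..int N}. fourier_coeff h k * z powi k)" for z
  have "fourier_partial_sum h N x = (\<Sum>k\<in>{- int N..int N}. fourier_coeff h k * cis x powi k)" for x
    unfolding fourier_partial_sum_def cis_power_int by (simp add: cis_conv_exp mult_ac)
  then have "h x = F (cis x)" for x
    unfolding F_def using N[of x] by (metis Re_complex_of_real)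
  moreover have "continuous_on (sphere 0 1) F"
    unfolding F_def by (intro continuous_intros) auto
  ultimately show ?thesis
    unfolding circle_fun_def by blast
qed

lemma circle_fun_continuous:
  assumes "circle_fun f"
  shows "continuous_on S f"
proof -
  obtain F where F: "continuous_on (sphere 0 1) F" "f = (\<lambda>x. F (cis x))"
    using assms by (auto simp: circle_fun_def)
  have "continuous_on S cis"
    by (intro continuous_intros)
  then show ?thesis
    unfolding F(2) by (rule continuous_on_compose2[OF F(1)]) auto
qed

lemma circle_fun_bounded:
  assumes "circle_fun f"
  obtains B where "0 < B" "\<And>x. \<bar>f x\<bar> \<le> B"
proof -
  obtain F where F: "continuous_on (sphere 0 1) F" "f = (\<lambda>x. F (cis x))"
    using assms by (auto simp: circle_fun_def)
  have "bounded (F ` sphere 0 1)"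
    by (intro compact_imp_bounded compact_continuous_image F compact_sphere)
  then obtain B where "0 < B" "\<And>z. z \<in> sphere 0 1 \<Longrightarrow> norm (F z) \<le> B"
    unfolding bounded_pos by auto
  then show thesis
    by (intro that[of B]) (auto simp: F(2))
qed

lemma circle_fun_clamp_diff:
  assumes "circle_fun f" "circle_fun h"
  shows "circle_fun (\<lambda>x. max (- c) (min c (f x - h x)))"
proof -
  obtain F H where FH: "continuous_on (sphere 0 1) F" "f = (\<lambda>x. F (cis x))"
      "continuous_on (sphere 0 1) H" "h = (\<lambda>x. H (cis x))"
    using assms by (auto simp: circle_fun_def)
  have "continuous_on (sphere 0 1) (\<lambda>z. max (- c) (min c (F z - H z)))"
    by (intro continuous_intros FH)
  then show ?thesis
    unfolding circle_fun_def FH(2,4) by blast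
qed

lemma suminf_tail_small:
  fixes \<kappa> :: "nat \<Rightarrow> real"
  assumes "summable \<kappa>" "0 < e"
  obtains M where "m \<le> M" "\<bar>(\<Sum>i. \<kappa> (i + M))\<bar> < e"
proof -
  obtain N where "\<And>n. n \<ge> N \<Longrightarrow> norm (\<Sum>i. \<kappa> (i + n)) < e"
    using suminf_exist_split[OF assms(2,1)] by blast
  then show thesis
    by (intro that[of "max m N"]) auto
qed

text \<open>
  Functions whose partial sums are bounded uniformly in \<open>N\<close> form a complete space, in which the
  trigonometric polynomials, the functions that satisfy the first assumption, have uniformly
  convergent Fourier series. A series with summable bounds inherits this: its partial sums
  differ from those of a finite section by at most the tail, for all \<open>N\<close> at once.
\<close>

lemma fourier_series_of_series:
  fixes h :: "nat \<Rightarrow> real \<Rightarrow> real"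
  assumes stable: "\<And>n. \<exists>N0. \<forall>N\<ge>N0. \<forall>x. fourier_partial_sum (h n) N x = of_real (h n x)"
    and bound: "\<And>n N x. cmod (fourier_partial_sum (h n) N x) \<le> \<kappa> n"
    and \<kappa>: "summable \<kappa>"
  shows "continuous_on S (\<lambda>x. \<Sum>n. h n x)"
    and "uniformly_convergent_fourier (\<lambda>x. \<Sum>n. h n x)"
    and "\<And>x. summable (\<lambda>n. h n x)"
proof -
  have h_cont: "continuous_on S (h n)" for n S
    by (intro circle_fun_continuous stable_imp_circle_fun stable)
  have h_le: "norm (h n x) \<le> \<kappa> n" for n x
    using stable[of n] bound[of n _ x] by (metis norm_of_real order_refl real_norm_def)
  have summ: "summable (\<lambda>n. h n x)" for x
    by (rule summable_comparison_test'[OF \<kappa>]) (rule h_le)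
  then show "\<And>x. summable (\<lambda>n. h n x)" .
  define g where "g x = (\<Sum>n. h n x)" for x
  define G where "G m x = (\<Sum>n<m. h n x)" for m x
  define tail where "tail m = (\<Sum>i. \<kappa> (i + m))" for m
  have summ\<kappa>: "summable (\<lambda>i. \<kappa> (i + m))" for m
    using \<kappa> by (simp add: summable_iff_shift)
  have "uniform_limit S (\<lambda>m x. \<Sum>n<m. h n x) g sequentially" for S
    unfolding g_def by (rule Weierstrass_m_test[OF h_le \<kappa>])
  then have g_cont: "continuous_on S g" for S
    by (rule uniform_limit_theorem[rotated]) (auto intro!: always_eventually continuous_on_sum h_cont)
  then show "continuous_on S (\<lambda>x. \<Sum>n. h n x)"
    unfolding g_def .
  have G_cont: "continuous_on S (G m)" for S m
    unfolding G_def by (intro continuous_on_sum h_cont)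
  have gG: "\<bar>g x - G m x\<bar> \<le> tail m" for x m
  proof -
    have "g x - G m x = (\<Sum>i. h (i + m) x)"
      unfolding g_def G_def using suminf_split_initial_segment[OF summ, of x m] by simp
    also have "norm \<dots> \<le> tail m"
      unfolding tail_def by (rule norm_suminf_le[OF h_le summ\<kappa>])
    finally show ?thesis
      by simp
  qed
  have fps_G: "fourier_partial_sum (G m) N x = (\<Sum>n<m. fourier_partial_sum (h n) N x)" for m N x
    unfolding G_def by (rule fourier_partial_sum_sum) (auto intro: h_cont)
  have far: "cmod (fourier_partial_sum g N x - fourier_partial_sum (G m) N x) \<le> tail m" for m N x
  \<comment> \<open>Finite sections are compared first. The passage to the infinite sum costs a multiple of \<open>tail M\<close>
    that depends on \<open>N\<close> but tends to \<open>0\<close> as \<open>M\<close> grows.\<close>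
  proof (rule field_le_epsilon)
    fix e :: real
    assume "0 < e"
    then have "0 < e / (2 * real N + 1)"
      by simp
    then obtain M where M: "m \<le> M" "\<bar>tail M\<bar> < e / (2 * real N + 1)"
      unfolding tail_def by (rule suminf_tail_small[OF \<kappa>])
    have "cmod (fourier_partial_sum g N x - fourier_partial_sum (G M) N x) \<le> (2 * real N + 1) * tail M"
      unfolding fourier_partial_sum_diff[OF g_cont G_cont, symmetric]
      by (intro norm_fourier_partial_sum_le continuous_on_diff g_cont G_cont gG)
    also have "\<dots> \<le> e"
    proof -
      have "tail M < e / (2 * real N + 1)"
        using M(2) by linarith
      then show ?thesis
        by (simp add: pos_less_divide_eq mult.commute)
    qed
    finally have 1: "cmod (fourier_partial_sum g N x - fourier_partial_sum (G M) N x) \<le> e" .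
    have "fourier_partial_sum (G M) N x - fourier_partial_sum (G m) N x = (\<Sum>n\<in>{m..<M}. fourier_partial_sum (h n) N x)"
      unfolding fps_G using sum_diff_nat_ivl[of 0 m M "\<lambda>n. fourier_partial_sum (h n) N x"] M(1)
      by (simp add: atLeast0LessThan)
    also have "cmod \<dots> \<le> (\<Sum>n\<in>{m..<M}. \<kappa> n)"
      by (intro sum_norm_le bound)
    also have "\<dots> = (\<Sum>i<M - m. \<kappa> (i + m))"
      using sum.shift_bounds_nat_ivl[of \<kappa> 0 m "M - m"] M(1) by (simp add: atLeast0LessThan)
    also have "\<dots> \<le> tail m"
      unfolding tail_def
      by (intro sum_le_suminf summ\<kappa>) (auto intro: order_trans[OF norm_ge_zero h_le])
    finally have 2: "cmod (fourier_partial_sum (G M) N x - fourier_partial_sum (G m) N x) \<le> tail m" .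
    show "cmod (fourier_partial_sum g N x - fourier_partial_sum (G m) N x) \<le> tail m + e"
      using 1 2 norm_triangle_ineq[of "fourier_partial_sum g N x - fourier_partial_sum (G M) N x"
          "fourier_partial_sum (G M) N x - fourier_partial_sum (G m) N x"] by simp
  qed
  have "uniform_limit {0..2*pi} (fourier_partial_sum g) (\<lambda>x. complex_of_real (g x)) sequentially"
  proof (rule uniform_limitI)
    fix e :: real
    assume "0 < e"
    then have "0 < e / 2"
      by simp
    then obtain m where m: "\<bar>tail m\<bar> < e / 2"
      unfolding tail_def by (rule suminf_tail_small[OF \<kappa>, where m = 0])
    have "eventually (\<lambda>N. \<forall>n\<in>{..<m}. \<forall>x. fourier_partial_sum (h n) N x = of_real (h n x)) sequentially"
      by (intro eventually_ball_finite) (use stable in \<open>auto simp: eventually_sequentially\<close>)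
    then show "eventually (\<lambda>N. \<forall>x\<in>{0..2*pi}. dist (fourier_partial_sum g N x) (complex_of_real (g x)) < e) sequentially"
    proof eventually_elim
      case (elim N)
      show ?case
      proof
        fix x
        have "fourier_partial_sum (G m) N x = of_real (G m x)"
          using elim by (simp add: fps_G G_def)
        moreover have "cmod (complex_of_real (g x) - of_real (G m x)) \<le> tail m"
          using gG[of x m] by (simp flip: of_real_diff)
        ultimately show "dist (fourier_partial_sum g N x) (complex_of_real (g x)) < e"
          using far[of N x m] m
            norm_triangle_ineq4[of "fourier_partial_sum g N x - fourier_partial_sum (G m) N x" "complex_of_real (g x) - of_real (G m x)"]
          by (simp add: dist_norm)
      qed
    qed
  qed
  then show "uniformly_convergent_fourier (\<lambda>x. \<Sum>n. h n x)"
    unfolding uniformly_convergent_fourier_def uniformly_convergent_on_def g_def[abs_def] by blast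
qed

text \<open>
  Each correction leaves an error that is small off a small set; clamping makes the error small
  everywhere without changing it off that set, and the clamped error is corrected in turn. The
  accuracy \<open>B (Suc n)\<close> of a step is chosen after the constant \<open>C (Suc n)\<close> of the next one, so that the
  bounds \<open>C n * B n\<close> are summable.
\<close>

lemma exact_correction:
  fixes \<mu> :: "real measure"
  assumes \<mu>: "finite_measure \<mu>" and meas: "(\<lambda>x. x) \<in> borel_measurable \<mu>" and \<epsilon>: "0 < \<epsilon>"
    and f: "circle_fun f"
  obtains g A where "continuous_on {0..2*pi} g" "uniformly_convergent_fourier g"
    "A \<in> sets \<mu>" "measure \<mu> A \<le> \<epsilon>" "\<And>x. x \<in> space \<mu> - A \<Longrightarrow> f x = g x"
proof -
  interpret finite_measure \<mu> by fact
  define R where "R c e \<delta> f h A \<longleftrightarrow>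
      (\<exists>N0. \<forall>N\<ge>N0. \<forall>x. fourier_partial_sum h N x = of_real (h x)) \<and>
      (\<forall>N x. cmod (fourier_partial_sum h N x) \<le> c) \<and>
      A \<in> sets \<mu> \<and> measure \<mu> A \<le> e \<and> (\<forall>x\<in>space \<mu> - A. \<bar>f x - h x\<bar> \<le> \<delta>)"
    for c e \<delta> :: real and f h :: "real \<Rightarrow> real" and A
  define \<epsilon>' where "\<epsilon>' n = \<epsilon> * (1 / 2) ^ Suc n" for n
  have "\<exists>C\<ge>1. \<forall>\<delta> B f. 0 < \<delta> \<longrightarrow> 0 < B \<longrightarrow> circle_fun f \<longrightarrow> (\<forall>x. \<bar>f x\<bar> \<le> B) \<longrightarrow>
      (\<exists>h A. R (C * B) (\<epsilon>' n) \<delta> f h A)" for n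
  proof -
    have "0 < \<epsilon>' n"
      using \<epsilon> by (simp add: \<epsilon>'_def)
    from approximate_correction[OF \<mu> meas this] show ?thesis
      unfolding R_def by metis
  qed
  then obtain C where C1: "\<And>n. 1 \<le> C n"
    and C: "\<And>n \<delta> B f. 0 < \<delta> \<Longrightarrow> 0 < B \<Longrightarrow> circle_fun f \<Longrightarrow> (\<forall>x. \<bar>f x\<bar> \<le> B) \<Longrightarrow>
      \<exists>h A. R (C n * B) (\<epsilon>' n) \<delta> f h A"
    by metis
  obtain B0 where B0: "0 < B0" "\<And>x. \<bar>f x\<bar> \<le> B0"
    using circle_fun_bounded[OF f] by blast
  define B where "B n = (case n of 0 \<Rightarrow> B0 | Suc k \<Rightarrow> (1 / 2) ^ k / C (Suc k))" for n
  have C_pos: "0 < C n" for n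
    using C1[of n] by simp
  have B_pos: "0 < B n" for n
    using B0 C_pos by (simp add: B_def split: nat.split)
  define hA where "hA n f = (SOME p. R (C n * B n) (\<epsilon>' n) (B (Suc n)) f (fst p) (snd p))" for n f
  define H where "H n f = fst (hA n f)" for n f
  define Bad where "Bad n f = snd (hA n f)" for n f
  have HB: "R (C n * B n) (\<epsilon>' n) (B (Suc n)) f (H n f) (Bad n f)"
    if f: "circle_fun f" "\<forall>x. \<bar>f x\<bar> \<le> B n" for n f
  proof -
    obtain h A where "R (C n * B n) (\<epsilon>' n) (B (Suc n)) f h A"
      using C[where \<delta> = "B (Suc n)" and B = "B n" and f = f and n = n, OF B_pos B_pos f] by blast
    then have "R (C n * B n) (\<epsilon>' n) (B (Suc n)) f (fst (h, A)) (snd (h, A))"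
      by simp
    then show ?thesis
      unfolding H_def Bad_def hA_def by (rule someI)
  qed
  define F where "F = rec_nat f (\<lambda>n f x. max (- B (Suc n)) (min (B (Suc n)) (f x - H n f x)))"
  have F_0: "F 0 = f" and F_Suc: "F (Suc n) = (\<lambda>x. max (- B (Suc n)) (min (B (Suc n)) (F n x - H n (F n) x)))" for n
    by (simp_all add: F_def)
  have F: "circle_fun (F n) \<and> (\<forall>x. \<bar>F n x\<bar> \<le> B n)" for n
  proof (induction n)
    case 0
    then show ?case
      using f B0 by (simp add: F_0 B_def)
  next
    case (Suc n)
    then have "circle_fun (H n (F n))"
      using HB[of "F n" n] by (intro stable_imp_circle_fun) (auto simp: R_def)
    moreover have "\<bar>max (- B (Suc n)) (min (B (Suc n)) t)\<bar> \<le> B (Suc n)" for t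
      using B_pos[of "Suc n"] by linarith
    ultimately show ?case
      using Suc unfolding F_Suc by (auto intro: circle_fun_clamp_diff)
  qed
  define h where "h n = H n (F n)" for n
  define A where "A n = Bad n (F n)" for n
  have R: "R (C n * B n) (\<epsilon>' n) (B (Suc n)) (F n) (h n) (A n)" for n
    using HB F unfolding h_def A_def by blast
  have half: "summable (\<lambda>n. (1 / 2 :: real) ^ n)"
    by (rule summable_geometric) simp
  have "C (Suc n) * B (Suc n) = (1 / 2) ^ n" for n
    using C_pos[of "Suc n"] by (simp add: B_def)
  then have "summable (\<lambda>n. C (Suc n) * B (Suc n))"
    using half by (simp only:)
  then have \<kappa>: "summable (\<lambda>n. C n * B n)"
    by (simp only: summable_Suc_iff[of "\<lambda>n. C n * B n"])
  define g where "g x = (\<Sum>n. h n x)" for x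
  note series = fourier_series_of_series[of h "\<lambda>n. C n * B n", OF _ _ \<kappa>]
  have g: "continuous_on {0..2*pi} g" "uniformly_convergent_fourier g"
    and summ: "summable (\<lambda>n. h n x)" for x
    unfolding g_def[abs_def] by (rule series; use R in \<open>simp add: R_def\<close>)+
  have A_sets: "A n \<in> sets \<mu>" and A_le: "measure \<mu> (A n) \<le> \<epsilon>' n" for n
    using R[of n] by (simp_all add: R_def)
  have \<epsilon>'_sums: "\<epsilon>' sums \<epsilon>"
    unfolding \<epsilon>'_def using sums_mult[OF power_half_series, of \<epsilon>] by simp
  have A_summ: "summable (\<lambda>n. measure \<mu> (A n))"
    by (rule summable_comparison_test'[OF sums_summable[OF \<epsilon>'_sums]]) (use A_le in simp)
  have "measure \<mu> (\<Union>n. A n) \<le> (\<Sum>n. measure \<mu> (A n))"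
    using A_sets by (intro finite_measure_subadditive_countably A_summ) auto
  also have "\<dots> \<le> (\<Sum>n. \<epsilon>' n)"
    by (intro suminf_le A_le A_summ sums_summable[OF \<epsilon>'_sums])
  also have "\<dots> = \<epsilon>"
    using \<epsilon>'_sums by (simp add: sums_iff)
  finally have A: "measure \<mu> (\<Union>n. A n) \<le> \<epsilon>" .
  have "f x = g x" if x: "x \<in> space \<mu> - (\<Union>n. A n)" for x
  proof -
    have step: "F (Suc n) x = F n x - h n x" for n
    proof -
      have "\<bar>F n x - h n x\<bar> \<le> B (Suc n)"
        using R[of n] x unfolding R_def by blast
      then show ?thesis
        unfolding F_Suc h_def by linarith
    qed
    have F_eq: "F n x = f x - (\<Sum>i<n. h i x)" for n
      by (induction n) (simp_all add: F_0 step)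
    have "\<bar>f x - (\<Sum>i<Suc n. h i x)\<bar> \<le> (1 / 2) ^ n" for n
    proof -
      have "\<bar>f x - (\<Sum>i<Suc n. h i x)\<bar> \<le> B (Suc n)"
        using F[of "Suc n"] unfolding F_eq[symmetric] by blast
      also have "\<dots> \<le> (1 / 2) ^ n"
        using C1[of "Suc n"] by (simp add: B_def divide_le_eq mult_le_cancel_left1 mult_left_le mult_le_cancel_right1)
      finally show ?thesis .
    qed
    then have "(\<lambda>n. f x - (\<Sum>i<Suc n. h i x)) \<longlonglongrightarrow> 0"
      by (intro Lim_null_comparison[OF _ summable_LIMSEQ_zero[OF half]]) (auto intro!: always_eventually)
    moreover have "(\<lambda>n. f x - (\<Sum>i<Suc n. h i x)) \<longlonglongrightarrow> f x - g x"
      unfolding g_def by (intro tendsto_intros LIMSEQ_Suc summable_LIMSEQ summ)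
    ultimately have "f x - g x = 0"
      using LIMSEQ_unique by blast
    then show ?thesis
      by simp
  qed
  then show thesis
    using g A A_sets by (intro that[of g "\<Union>n. A n"]) auto
qed

section \<open>Reduction of measurable functions to continuous ones\<close>

lemma compact_inner_approx:
  fixes \<nu> :: "'a::{second_countable_topology, complete_space} measure"
  assumes \<nu>: "finite_measure \<nu>" "sets \<nu> = sets borel" and B: "B \<in> sets borel" and e: "0 < e"
  obtains K where "K \<subseteq> B" "compact K" "measure \<nu> (B - K) \<le> e"
proof -
  interpret finite_measure \<nu> by fact
  have sB: "B \<in> sets \<nu>"
    using B \<nu>(2) by simp
  have "\<exists>K. K \<subseteq> B \<and> compact K \<and> measure \<nu> B - e \<le> measure \<nu> K"
  proof (cases "measure \<nu> B \<le> e")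
    case True
    then show ?thesis
      by (intro exI[of _ "{}"]) auto
  next
    case False
    have "ennreal (measure \<nu> B - e) < emeasure \<nu> B"
      using False e by (simp add: emeasure_eq_measure ennreal_less_iff)
    also have "emeasure \<nu> B = (SUP K\<in>{K. K \<subseteq> B \<and> compact K}. emeasure \<nu> K)"
      by (rule inner_regular[OF \<nu>(2) _ B]) simp
    finally obtain K where K: "K \<subseteq> B" "compact K" "ennreal (measure \<nu> B - e) < emeasure \<nu> K"
      by (auto simp: less_SUP_iff)
    then have "measure \<nu> B - e \<le> measure \<nu> K"
      using False by (simp add: emeasure_eq_measure ennreal_less_iff)
    then show ?thesis
      using K by blast
  qed
  then obtain K where K: "K \<subseteq> B" "compact K" "measure \<nu> B - e \<le> measure \<nu> K"
    by blast
  have "K \<in> sets \<nu>"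
    using K(2) \<nu>(2) by (simp add: borel_compact)
  then have "measure \<nu> (B - K) = measure \<nu> B - measure \<nu> K"
    using sB K(1) by (simp add: finite_measure_Diff)
  then show thesis
    using K by (intro that[of K]) auto
qed

text \<open>
  The preimages of a countable basis and their
  complements are approximated from inside by compact sets \<open>P n\<close> and \<open>N n\<close>. On the intersection of all
  \<open>P n \<union> N n\<close> the \<open>n\<close>-th preimage is the complement of \<open>N n\<close>, hence relatively open.
\<close>

lemma lusin:
  fixes \<nu> :: "'a::{second_countable_topology, complete_space} measure"
    and f :: "'a \<Rightarrow> 'b::second_countable_topology"
  assumes \<nu>: "finite_measure \<nu>" "sets \<nu> = sets borel" and f: "f \<in> borel_measurable borel" and e: "0 < e"
  obtains K where "compact K" "measure \<nu> (- K) \<le> e" "continuous_on K f"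
proof -
  interpret finite_measure \<nu> by fact
  obtain \<B> :: "'b set set" where \<B>: "countable \<B>" "topological_basis \<B>"
    using ex_countable_basis by blast
  have "\<B> \<noteq> {}"
    using \<B>(2) by (metis UNIV_I empty_iff open_UNIV topological_basisE)
  then obtain U :: "nat \<Rightarrow> 'b set" where U: "range U = \<B>"
    using \<B>(1) uncountable_def by metis
  define V where "V n = f -` U n" for n
  have V: "V n \<in> sets borel" for n
  proof -
    have "U n \<in> \<B>"
      using U by blast
    then have "open (U n)"
      using \<B>(2) topological_basis_open by blast
    then show ?thesis
      unfolding V_def using measurable_sets[OF f] by fastforce
  qed
  define r where "r n = e * (1 / 2) ^ Suc n" for n
  have r: "0 < r n / 2" for n
    using e by (simp add: r_def)
  have "\<exists>K. K \<subseteq> V n \<and> compact K \<and> measure \<nu> (V n - K) \<le> r n / 2" for n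
    using compact_inner_approx[OF \<nu> V r] by metis
  then obtain P where P: "\<And>n. P n \<subseteq> V n" "\<And>n. compact (P n)" "\<And>n. measure \<nu> (V n - P n) \<le> r n / 2"
    by metis
  have "- V n \<in> sets borel" for n
    using V by (simp add: borel_comp)
  then have "\<exists>K. K \<subseteq> - V n \<and> compact K \<and> measure \<nu> (- V n - K) \<le> r n / 2" for n
    using compact_inner_approx[OF \<nu> _ r] by metis
  then obtain N where N: "\<And>n. N n \<subseteq> - V n" "\<And>n. compact (N n)" "\<And>n. measure \<nu> (- V n - N n) \<le> r n / 2"
    by metis
  define K where "K = (\<Inter>n. P n \<union> N n)"
  have closed: "closed (P n)" "closed (N n)" for n
    using P(2) N(2) by (simp_all add: compact_imp_closed)
  have [simp]: "P n \<in> sets \<nu>" "N n \<in> sets \<nu>" "V n \<in> sets \<nu>" "- V n \<in> sets \<nu>" for n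
    using closed V by (simp_all add: \<nu>(2) borel_closed borel_comp)
  have "compact (P 0 \<union> N 0)"
    using P N by (intro compact_Un)
  moreover have "closed K"
    unfolding K_def using closed by (intro closed_INT) auto
  moreover have "K \<subseteq> P 0 \<union> N 0"
    by (auto simp: K_def)
  ultimately have "compact K"
    by (metis closed_Int_compact inf.absorb_iff1)
  have r_sums: "r sums e"
    unfolding r_def using sums_mult[OF power_half_series, of e] by simp
  have diff: "V n - P n \<in> sets \<nu>" "- V n - N n \<in> sets \<nu>" for n
    by (intro sets.Diff; simp)+
  have le: "measure \<nu> ((V n - P n) \<union> (- V n - N n)) \<le> r n" for n
    using measure_Un_le[of "V n - P n" \<nu> "- V n - N n", OF diff] P(3)[of n] N(3)[of n] by linarith
  have summ: "summable (\<lambda>n. measure \<nu> ((V n - P n) \<union> (- V n - N n)))"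
    by (rule summable_comparison_test'[OF sums_summable[OF r_sums]]) (use le in simp)
  have "- K = (\<Union>n. (V n - P n) \<union> (- V n - N n))"
    using P(1) N(1) by (fastforce simp: K_def)
  then have "measure \<nu> (- K) \<le> (\<Sum>n. measure \<nu> ((V n - P n) \<union> (- V n - N n)))"
    by (simp only:) (intro finite_measure_subadditive_countably summ image_subsetI sets.Un diff)
  also have "\<dots> \<le> (\<Sum>n. r n)"
    by (intro suminf_le le summ sums_summable[OF r_sums])
  also have "\<dots> = e"
    using r_sums by (simp add: sums_iff)
  finally have small: "measure \<nu> (- K) \<le> e" .
  have "continuous_on K f"
    unfolding continuous_on_open_invariant
  proof (intro allI impI)
    fix W :: "'b set"
    assume "open W"
    then obtain \<C> where \<C>: "\<C> \<subseteq> \<B>" "W = \<Union>\<C>"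
      using \<B>(2) unfolding topological_basis_def by metis
    have "(\<Union>n\<in>{n. U n \<in> \<C>}. - N n) \<inter> K = f -` W \<inter> K"
    proof (intro equalityI subsetI)
      fix x
      assume "x \<in> (\<Union>n\<in>{n. U n \<in> \<C>}. - N n) \<inter> K"
      then obtain n where n: "U n \<in> \<C>" "x \<notin> N n" "x \<in> K"
        by blast
      then have "x \<in> V n"
        using P(1) unfolding K_def by blast
      then show "x \<in> f -` W \<inter> K"
        using n \<C>(2) by (auto simp: V_def)
    next
      fix x
      assume x: "x \<in> f -` W \<inter> K"
      then obtain n where "U n \<in> \<C>" "f x \<in> U n"
        using \<C> U by blast
      then show "x \<in> (\<Union>n\<in>{n. U n \<in> \<C>}. - N n) \<inter> K"
        using x N(1)[of n] by (auto simp: V_def)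
    qed
    moreover have "open (\<Union>n\<in>{n. U n \<in> \<C>}. - N n)"
      using closed by auto
    ultimately show "\<exists>A. open A \<and> A \<inter> K = f -` W \<inter> K"
      by blast
  qed
  with \<open>compact K\<close> small show thesis
    by (rule that)
qed

lemma Arg2pi_borel_measurable: "Arg2pi \<in> borel_measurable borel"
  by (rule borel_measurableI_greater) (simp add: open_Arg2pi2pi_gt)

lemma Arg2pi_cis: "0 \<le> x \<Longrightarrow> x < 2 * pi \<Longrightarrow> Arg2pi (cis x) = x"
  by (rule Arg2pi_unique[of 1]) (auto simp: cis_conv_exp)

section \<open>Menshov's theorem for finite Borel measures\<close>

theorem mainTheorem1:
  fixes f :: "real \<Rightarrow> real" and \<mu> :: "real measure"
  assumes f_borel: "f \<in> borel_measurable (restrict_space borel {0..2*pi})"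
    and mu_borel: "sets \<mu> = sets (restrict_space borel {0..2*pi})"
    and mu_finite: "finite_measure \<mu>"
    and endpoints: "f 0 = f (2*pi) \<or> measure \<mu> {0} = 0 \<or> measure \<mu> {2*pi} = 0"
  shows "\<forall>\<epsilon>>0. \<exists>g :: real \<Rightarrow> real.
           continuous_on {0..2*pi} g \<and>
           uniformly_convergent_fourier g \<and>
           measure \<mu> {x \<in> {0..2*pi}. f x \<noteq> g x} < \<epsilon>"
proof (intro allI impI)
  fix \<epsilon> :: real
  assume \<epsilon>: "0 < \<epsilon>"
  interpret finite_measure \<mu> by (rule mu_finite)
  have space: "space \<mu> = {0..2*pi}"
    using sets_eq_imp_space_eq[OF mu_borel] by (simp add: space_restrict_space)
  have meas_eq: "measurable \<mu> borel = measurable (restrict_space borel {0..2*pi}) borel"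
    by (rule measurable_cong_sets[OF mu_borel refl])
  have id_meas: "(\<lambda>x. x) \<in> borel_measurable \<mu>"
    unfolding meas_eq by (intro measurable_restrict_space1) simp
  have cis_meas: "cis \<in> measurable \<mu> borel"
    using measurable_compose[OF id_meas cis_borel_measurable] .
  \<comment> \<open>The endpoints are one point of the circle. If the values of \<open>f\<close> differ there, the value at the
    endpoint \<open>x\<^sub>0\<close>, which has measure \<open>0\<close>, is given up.\<close>
  define x\<^sub>0 where "x\<^sub>0 = (if measure \<mu> {0} = 0 then 0 else 2 * pi)"
  define f' where "f' z = (if z = 1 then f (2 * pi - x\<^sub>0) else f (Arg2pi z))" for z
  have f'_eq: "f' (cis x) = f x" if "x \<in> {0..2*pi}" "f 0 = f (2*pi) \<or> x \<noteq> x\<^sub>0" for x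
  proof (cases "x = 0 \<or> x = 2 * pi")
    case True
    then show ?thesis
      using that by (auto simp: f'_def x\<^sub>0_def)
  next
    case False
    then have "0 < x" "x < 2 * pi"
      using that by auto
    then have "Arg2pi (cis x) = x"
      by (intro Arg2pi_cis) auto
    then have "cis x \<noteq> 1"
      using \<open>0 < x\<close> Arg2pi_cis[of 0] by auto
    with \<open>Arg2pi (cis x) = x\<close> show ?thesis
      by (simp add: f'_def)
  qed
  define Z where "Z = (if f 0 = f (2*pi) then {} else {x\<^sub>0})"
  have Z: "measure \<mu> Z = 0"
    using endpoints by (auto simp: Z_def x\<^sub>0_def)
  have "{y} \<in> sets \<mu>" if "y \<in> {0..2*pi}" for y
    unfolding mu_borel using that by (auto simp: sets_restrict_space_iff)
  then have Z_sets: "Z \<in> sets \<mu>"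
    by (auto simp: Z_def x\<^sub>0_def)
  have "Arg2pi \<in> measurable borel (restrict_space borel {0..2*pi})"
    using Arg2pi by (intro measurable_restrict_space2 Arg2pi_borel_measurable) (auto simp: less_imp_le)
  then have "(\<lambda>z. f (Arg2pi z)) \<in> borel_measurable borel"
    by (rule measurable_compose) (rule f_borel)
  then have f'_meas: "f' \<in> borel_measurable borel"
    unfolding f'_def by (intro measurable_If) auto
  define \<nu> where "\<nu> = distr \<mu> borel cis"
  have \<nu>: "finite_measure \<nu>" "sets \<nu> = sets borel"
    unfolding \<nu>_def by (intro finite_measure_distr cis_meas) simp
  obtain K where K: "compact K" "measure \<nu> (- K) \<le> \<epsilon> / 3" "continuous_on K f'"
    by (rule lusin[OF \<nu> f'_meas, of "\<epsilon> / 3"]) (use \<epsilon> in auto)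
  obtain F where F: "continuous_on UNIV F" "\<And>z. z \<in> K \<Longrightarrow> F z = f' z"
    by (rule Tietze_unbounded[OF K(3), of UNIV]) (use K(1) in \<open>auto simp: compact_imp_closed\<close>)
  have "circle_fun (\<lambda>x. F (cis x))"
    unfolding circle_fun_def using F(1) continuous_on_subset by blast
  then obtain g A where g: "continuous_on {0..2*pi} g" "uniformly_convergent_fourier g"
    and A: "A \<in> sets \<mu>" "measure \<mu> A \<le> \<epsilon> / 3" "\<And>x. x \<in> space \<mu> - A \<Longrightarrow> F (cis x) = g x"
    using exact_correction[OF mu_finite id_meas, of "\<epsilon> / 3"] \<epsilon> by (metis divide_pos_pos zero_less_numeral)
  define Y where "Y = cis -` (- K) \<inter> space \<mu>"
  have K_sets: "- K \<in> sets borel"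
    using K(1) by (simp add: borel_comp borel_compact)
  have Y: "Y \<in> sets \<mu>" "measure \<mu> Y \<le> \<epsilon> / 3"
    using measurable_sets[OF cis_meas K_sets] K(2) measure_distr[OF cis_meas K_sets]
    by (simp_all add: Y_def \<nu>_def)
  have "{x \<in> {0..2*pi}. f x \<noteq> g x} \<subseteq> A \<union> Y \<union> Z"
  proof
    fix x
    assume x: "x \<in> {x \<in> {0..2*pi}. f x \<noteq> g x}"
    show "x \<in> A \<union> Y \<union> Z"
    proof (rule ccontr)
      assume nx: "x \<notin> A \<union> Y \<union> Z"
      then have "cis x \<in> K"
        using x by (auto simp: Y_def space)
      then have "g x = f' (cis x)"
        using A(3)[of x] F(2) nx x by (simp add: space)
      also have "\<dots> = f x"
        using nx x by (intro f'_eq) (auto simp: Z_def split: if_splits)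
      finally show False
        using x by simp
    qed
  qed
  then have "measure \<mu> {x \<in> {0..2*pi}. f x \<noteq> g x} \<le> measure \<mu> (A \<union> Y \<union> Z)"
    by (intro finite_measure_mono) (use A(1) Y(1) Z_sets in auto)
  also have "\<dots> \<le> measure \<mu> A + measure \<mu> Y + measure \<mu> Z"
    using measure_Un_le[of "A \<union> Y" \<mu> Z] measure_Un_le[of A \<mu> Y] A(1) Y(1) Z_sets by simp
  also have "\<dots> < \<epsilon>"
    using A(2) Y(2) Z \<epsilon> by linarith
  finally show "\<exists>g. continuous_on {0..2*pi} g \<and> uniformly_convergent_fourier g \<and>
      measure \<mu> {x \<in> {0..2*pi}. f x \<noteq> g x} < \<epsilon>"
    using g by blast
qed

end
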